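(* Let $N \geq 2$ and let $f$ be quasimeromorphic in $\mathbb{R}^N$ with infinitely many poles in $\mathbb{R}^N$. Then the escaping set $I(f) = \{ x \in \mathbb{R}^N : \lim_{n\to\infty} f^n(x) = \infty \}$ is non-empty.
   Context: Write $\overline{\mathbb{R}^N} = \mathbb{R}^N \cup \{\infty\}$. A continuous mapping $f : G \to \mathbb{R}^N$ on an open set $G \subseteq \mathbb{R}^N$ is quasiregular if it belongs to the Sobolev space $W^{1}_{N,\mathrm{loc}}(G)$ and there is $K \in [1,\infty)$ with $|f'(x)|^N \leq K J_f(x)$ for almost every $x \in G$, where $|f'(x)|$ is the operator norm of the derivative and $J_f$ is the Jacobian determinant. A mapping $f : \mathbb{R}^N \to \overline{\mathbb{R}^N}$ that is not identically $\infty$ is quasimeromorphic if it is continuous, the set $f^{-1}(\infty)$ of its poles is discrete (i.e. closed in $\mathbb{R}^N$ with no accumulation points in $\mathbb{R}^N$), and $f$ is quasiregular on $\mathbb{R}^N \setminus f^{-1}(\infty)$. Iterates are $f^1 = f$, $f^{n+1} = f \circ f^n$; membership $x \in I(f)$ includes the requirement that $f^n(x)$ is defined and finite for every $n \geq 1$. *)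

theory Defs
  imports "HOL-Analysis.Analysis"
begin

text \<open>
  The extended space \<open>\<real>\<^sup>N \<union> {\<infinity>}\<close> is the type \<^typ>\<open>(real ^ 'n) option\<close> with
  \<^term>\<open>None\<close> as the point at infinity and \<^term>\<open>Alexandroff_compactification euclidean\<close>
  as its topology.
\<close>

definition partial_deriv :: "'n::finite \<Rightarrow> (real ^ 'n \<Rightarrow> real) \<Rightarrow> real ^ 'n \<Rightarrow> real" where
  "partial_deriv j \<phi> x = frechet_derivative \<phi> (at x) (axis j 1)"

primrec C_k :: "nat \<Rightarrow> (real ^ 'n::finite \<Rightarrow> real) \<Rightarrow> bool" where
  "C_k 0 \<phi> \<longleftrightarrow> continuous_on UNIV \<phi>"
| "C_k (Suc k) \<phi> \<longleftrightarrow> (\<forall>x. \<phi> differentiable (at x)) \<and> (\<forall>j. C_k k (partial_deriv j \<phi>))"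

definition test_function :: "(real ^ 'n::finite) set \<Rightarrow> (real ^ 'n \<Rightarrow> real) \<Rightarrow> bool" where
  "test_function G \<phi> \<longleftrightarrow>
     (\<forall>k. C_k k \<phi>) \<and> compact (closure {x. \<phi> x \<noteq> 0}) \<and> closure {x. \<phi> x \<noteq> 0} \<subseteq> G"

definition L_loc :: "nat \<Rightarrow> (real ^ 'n::finite) set \<Rightarrow> (real ^ 'n \<Rightarrow> real) \<Rightarrow> bool" where
  "L_loc p G u \<longleftrightarrow> u \<in> borel_measurable (lebesgue_on G) \<and>
     (\<forall>C. compact C \<and> C \<subseteq> G \<longrightarrow> integrable (lebesgue_on C) (\<lambda>x. \<bar>u x\<bar> ^ p))"

definition weak_partial_deriv ::
    "'n::finite \<Rightarrow> (real ^ 'n) set \<Rightarrow> (real ^ 'n \<Rightarrow> real) \<Rightarrow> (real ^ 'n \<Rightarrow> real) \<Rightarrow> bool" where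
  "weak_partial_deriv j G u v \<longleftrightarrow>
     (\<forall>\<phi>. test_function G \<phi> \<longrightarrow>
        (LINT x|lebesgue_on G. u x * partial_deriv j \<phi> x) = - (LINT x|lebesgue_on G. v x * \<phi> x))"

text \<open>
  \<open>W1_loc p G f D\<close>: \<open>f\<close> belongs to \<open>W\<^sup>1\<^sub>p\<^sub>,\<^sub>l\<^sub>o\<^sub>c(G)\<close>, with matrix of weak first-order partial
  derivatives \<open>D\<close>. The matrix is determined by \<open>f\<close> only almost everywhere in \<open>G\<close>, hence the
  relational form.
\<close>

definition W1_loc ::
    "nat \<Rightarrow> (real ^ 'n::finite) set \<Rightarrow> (real ^ 'n \<Rightarrow> real ^ 'n) \<Rightarrow> (real ^ 'n \<Rightarrow> real ^ 'n ^ 'n) \<Rightarrow> bool" where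
  "W1_loc p G f D \<longleftrightarrow>
     (\<forall>i. L_loc p G (\<lambda>x. f x $ i)) \<and>
     (\<forall>i j. L_loc p G (\<lambda>x. D x $ i $ j) \<and>
            weak_partial_deriv j G (\<lambda>x. f x $ i) (\<lambda>x. D x $ i $ j))"

definition quasiregular_on :: "(real ^ 'n::finite) set \<Rightarrow> (real ^ 'n \<Rightarrow> real ^ 'n) \<Rightarrow> bool" where
  "quasiregular_on G f \<longleftrightarrow>
     open G \<and> continuous_on G f \<and>
     (\<exists>D. W1_loc CARD('n) G f D \<and>
       (\<exists>K\<ge>1. AE x in lebesgue_on G. onorm ((*v) (D x)) ^ CARD('n) \<le> K * det (D x)))"

definition poles :: "(real ^ 'n::finite \<Rightarrow> (real ^ 'n) option) \<Rightarrow> (real ^ 'n) set" where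
  "poles f = f -` {None}"

definition quasimeromorphic :: "(real ^ 'n::finite \<Rightarrow> (real ^ 'n) option) \<Rightarrow> bool" where
  "quasimeromorphic f \<longleftrightarrow>
     (\<exists>x. f x \<noteq> None) \<and>
     continuous_map euclidean (Alexandroff_compactification euclidean) f \<and>
     closed (poles f) \<and> (\<forall>x. \<not> x islimpt poles f) \<and>
     quasiregular_on (- poles f) (\<lambda>x. the (f x))"

text \<open>
  \<open>f\<close> is not defined at \<open>\<infinity>\<close>. In \<open>iterate f n x\<close> the value \<^term>\<open>None\<close> therefore means that
  \<open>f\<^sup>n(x)\<close> is \<open>\<infinity>\<close> or undefined; both are excluded in the escaping set.
\<close>

primrec iterate :: "('a \<Rightarrow> 'a option) \<Rightarrow> nat \<Rightarrow> 'a \<Rightarrow> 'a option" where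
  "iterate f 0 x = Some x"
| "iterate f (Suc n) x = Option.bind (iterate f n x) f"

definition escaping_set :: "(real ^ 'n::finite \<Rightarrow> (real ^ 'n) option) \<Rightarrow> (real ^ 'n) set" where
  "escaping_set f =
     {x. (\<forall>n\<ge>1. iterate f n x \<noteq> None) \<and>
         limitin (Alexandroff_compactification euclidean) (\<lambda>n. iterate f n x) None sequentially}"

end

theory Submission
  imports Defs
begin

text \<open>
  Near a pole \<open>a\<close> the map covers a neighbourhood of \<open>\<infinity>\<close>. For this no openness theorem for
  quasiregular maps is needed. Let \<open>y\<close> be a value omitted in a punctured ball around \<open>a\<close>, with \<open>|y|\<close>
  larger than \<open>|f|\<close> on the bounding sphere, and let \<open>F(z) = g(|z - y|) (z - y)\<close> be supported in a
  ball around \<open>y\<close> whose preimage is compact. Then \<open>\<integral> (div F)(f) J\<^sub>f = 0\<close>, because the integrand is a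
  divergence (a null Lagrangian); for \<open>f\<close> in the Sobolev space \<open>W\<^sup>1\<^sub>N\<close> this follows by mollification.
  As \<open>f\<close> stays away from \<open>y\<close>, the profile \<open>g\<close> can be chosen so that \<open>div F < 0\<close> at all values of \<open>f\<close>
  in the ball. Since \<open>J\<^sub>f \<ge> 0\<close>, both \<open>J\<^sub>f\<close> and, by quasiregularity, \<open>f'\<close> vanish on the
  preimage of the ball, so \<open>f\<close> is locally constant there. Hence the whole ball is omitted, the omitted
  values form an open and closed subset of the connected set of large \<open>y\<close>, and this subset is empty
  because \<open>f\<close> is unbounded near \<open>a\<close>.

  The poles are unbounded, so there are balls \<open>B\<^sub>n\<close> around poles \<open>a\<^sub>n \<rightarrow> \<infinity>\<close> with
  \<open>f(B\<^sub>n) \<supseteq> B\<^sub>n\<^sub>+\<^sub>1\<close>; a compactness argument yields a point with \<open>f\<^sup>n(x) \<in> B\<^sub>n\<close> for all \<open>n\<close>.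
\<close>

section \<open>Functions of class \<open>C\<^sup>k\<close> and a smooth bump\<close>

text \<open>The obstacle is that \<open>f\<close> is only a Sobolev map: its derivative is a matrix
  of local \<open>L^N\<close> functions, while the divergence structure of
  \<open>(div F)(f) J_f\<close> uses two classical derivatives. So the identity is proved for
  \<open>C^2\<close> maps and transferred. The exponent \<open>N\<close> is what the transfer needs,
  because the determinant is homogeneous of degree \<open>N\<close> in the entries of the
  derivative. The mollified determinants have no obvious common majorant; they are dominated by
  mollifications of the \<open>N\<close>-th powers of the entries, whose integrals do not exceed
  that of the limit, and a dominated convergence theorem with varying majorants applies. The sign of
  \<open>div F\<close> comes from a steep profile. For \<open>g = t^(m+2)\<close>, where
  \<open>t\<close> is the positive part of \<open>\<rho>^2 - s\<close> and
  \<open>s = |z - y|^2\<close>, the divergence is \<open>t^(m+1) (N t - 2 (m+2) s)\<close>. It is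
  positive for \<open>z\<close> near \<open>y\<close>, but the values of \<open>f\<close> keep
  \<open>s\<close> above some \<open>\<epsilon>^2\<close>, and \<open>m\<close> is chosen after
  \<open>\<epsilon>\<close>. Values \<open>y\<close> larger than \<open>|f|\<close> on the bounding
  sphere have compact preimages in the open punctured ball, so all supports stay away from both the
  pole and the sphere.\<close>

definition grad :: "(real ^ 'n::finite \<Rightarrow> real) \<Rightarrow> real ^ 'n \<Rightarrow> real ^ 'n" where
  "grad \<phi> x = (\<chi> j. partial_deriv j \<phi> x)"

lemma grad_nth [simp]: "grad \<phi> x $ j = partial_deriv j \<phi> x"
  by (simp add: grad_def)

lemma partial_deriv_eqI:
  "(\<phi> has_derivative \<phi>') (at x) \<Longrightarrow> partial_deriv j \<phi> x = \<phi>' (axis j 1)"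
  unfolding partial_deriv_def using frechet_derivative_at by metis

lemma has_derivative_grad:
  fixes \<phi> :: "real ^ 'n::finite \<Rightarrow> real"
  assumes "\<phi> differentiable (at x)"
  shows "(\<phi> has_derivative (\<lambda>v. grad \<phi> x \<bullet> v)) (at x)"
proof -
  let ?D = "frechet_derivative \<phi> (at x)"
  have D: "(\<phi> has_derivative ?D) (at x)"
    using assms frechet_derivative_works by blast
  then have "linear ?D"
    using has_derivative_linear by blast
  have "?D v = grad \<phi> x \<bullet> v" for v
  proof -
    have "?D v = ?D (\<Sum>j\<in>UNIV. v $ j *\<^sub>R axis j 1)"
      using basis_expansion[of v] by (simp add: scalar_mult_eq_scaleR)
    also have "\<dots> = (\<Sum>j\<in>UNIV. v $ j * ?D (axis j 1))"
      using \<open>linear ?D\<close> by (simp add: linear_sum linear_cmul)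
    also have "\<dots> = grad \<phi> x \<bullet> v"
      by (simp add: inner_vec_def partial_deriv_def mult.commute)
    finally show ?thesis .
  qed
  then have "?D = (\<lambda>v. grad \<phi> x \<bullet> v)" by blast
  with D show ?thesis by simp
qed

lemma partial_deriv_const [simp]: "partial_deriv j (\<lambda>x. c) = (\<lambda>x. 0)"
  by (rule ext, subst partial_deriv_eqI[OF has_derivative_const]) simp

lemma partial_deriv_coord [simp]:
  "partial_deriv j (\<lambda>x::real^'n::finite. x $ i) = (\<lambda>x. if i = j then 1 else 0)"
proof
  fix x :: "real^'n"
  have "((\<lambda>x::real^'n. x $ i) has_derivative (\<lambda>v. v $ i)) (at x)"
    by (intro bounded_linear_imp_has_derivative bounded_linear_vec_nth)
  from partial_deriv_eqI[OF this, of j]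
  show "partial_deriv j (\<lambda>x. x $ i) x = (if i = j then 1 else 0)"
    by (simp add: axis_def)
qed

lemma partial_deriv_add:
  assumes "\<phi> differentiable (at x)" "\<psi> differentiable (at x)"
  shows "partial_deriv j (\<lambda>x. \<phi> x + \<psi> x) x = partial_deriv j \<phi> x + partial_deriv j \<psi> x"
  by (subst partial_deriv_eqI[OF has_derivative_add[OF assms[THEN has_derivative_grad]]])
     (simp add: inner_axis)

lemma partial_deriv_mult:
  assumes "\<phi> differentiable (at x)" "\<psi> differentiable (at x)"
  shows "partial_deriv j (\<lambda>x. \<phi> x * \<psi> x) x = \<phi> x * partial_deriv j \<psi> x + partial_deriv j \<phi> x * \<psi> x"
  by (subst partial_deriv_eqI[OF has_derivative_mult[OF assms[THEN has_derivative_grad]]])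
     (simp add: inner_axis)

lemma C_k_const [simp]: "C_k k (\<lambda>x. c)"
  by (induction k arbitrary: c) auto

lemma C_k_coord [simp]: "C_k k (\<lambda>x::real^'n::finite. x $ i)"
proof (cases k)
  case 0
  then show ?thesis by (auto intro: continuous_intros)
next
  case (Suc l)
  have "(\<lambda>x::real^'n. x $ i) differentiable (at x)" for x
    by (intro bounded_linear_imp_differentiable bounded_linear_vec_nth)
  with Suc show ?thesis by (auto simp: if_distrib)
qed

text \<open>The successor clause of \<open>C_k\<close> does not mention continuity; at the bottom of
  the recursion it comes from differentiability.\<close>

lemma C_k_Suc_D: "C_k (Suc k) \<phi> \<Longrightarrow> C_k k \<phi>"
proof (induction k arbitrary: \<phi>)
  case 0
  then show ?case
    by (auto simp: continuous_on_eq_continuous_at differentiable_imp_continuous_within)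
next
  case (Suc k)
  then show ?case by (metis C_k.simps(2))
qed

lemma C_k_mono: "C_k k \<phi> \<Longrightarrow> l \<le> k \<Longrightarrow> C_k l \<phi>"
  by (induction k) (auto simp: le_Suc_eq dest: C_k_Suc_D simp del: C_k.simps)

lemma C_k_differentiable: "C_k (Suc k) \<phi> \<Longrightarrow> \<phi> differentiable (at x)"
  by auto

lemma C_k_continuous: "C_k k \<phi> \<Longrightarrow> continuous_on UNIV \<phi>"
  using C_k_mono[of k \<phi> 0] by simp

lemma C_k_partial_deriv: "C_k (Suc k) \<phi> \<Longrightarrow> C_k k (partial_deriv j \<phi>)"
  by auto

lemma C_k_add: "C_k k \<phi> \<Longrightarrow> C_k k \<psi> \<Longrightarrow> C_k k (\<lambda>x. \<phi> x + \<psi> x)"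
proof (induction k arbitrary: \<phi> \<psi>)
  case 0
  then show ?case by (auto intro: continuous_intros)
next
  case (Suc k)
  then have "partial_deriv j (\<lambda>x. \<phi> x + \<psi> x) = (\<lambda>x. partial_deriv j \<phi> x + partial_deriv j \<psi> x)" for j
    by (intro ext partial_deriv_add) auto
  with Suc show ?case by auto
qed

lemma C_k_mult: "C_k k \<phi> \<Longrightarrow> C_k k \<psi> \<Longrightarrow> C_k k (\<lambda>x. \<phi> x * \<psi> x)"
proof (induction k arbitrary: \<phi> \<psi>)
  case 0
  then show ?case by (auto intro: continuous_intros)
next
  case (Suc k)
  then have *: "partial_deriv j (\<lambda>x. \<phi> x * \<psi> x) = (\<lambda>x. \<phi> x * partial_deriv j \<psi> x + partial_deriv j \<phi> x * \<psi> x)" for j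
    by (intro ext partial_deriv_mult) auto
  have "C_k k \<phi>" "C_k k \<psi>" "\<And>j. C_k k (partial_deriv j \<phi>)" "\<And>j. C_k k (partial_deriv j \<psi>)"
    using Suc.prems C_k_Suc_D by (blast, blast, auto)
  then have "C_k k (partial_deriv j (\<lambda>x. \<phi> x * \<psi> x))" for j
    unfolding * by (intro C_k_add Suc.IH)
  with Suc.prems show ?case by auto
qed

lemma C_k_sum: "(\<And>i. i \<in> I \<Longrightarrow> C_k k (\<phi> i)) \<Longrightarrow> C_k k (\<lambda>x. \<Sum>i\<in>I. \<phi> i x)"
  by (induction I rule: infinite_finite_induct) (auto intro: C_k_add)

lemma C_k_prod: "(\<And>i. i \<in> I \<Longrightarrow> C_k k (\<phi> i)) \<Longrightarrow> C_k k (\<lambda>x. \<Prod>i\<in>I. \<phi> i x)"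
  by (induction I rule: infinite_finite_induct) (auto intro: C_k_mult)

lemma partial_deriv_prod:
  assumes "finite I" "\<And>i. i \<in> I \<Longrightarrow> \<phi> i differentiable (at x)"
  shows "(\<lambda>x. \<Prod>i\<in>I. \<phi> i x) differentiable (at x)"
    and "partial_deriv j (\<lambda>x. \<Prod>i\<in>I. \<phi> i x) x = (\<Sum>l\<in>I. partial_deriv j (\<phi> l) x * (\<Prod>i\<in>I - {l}. \<phi> i x))"
proof -
  have D: "((\<lambda>x. \<Prod>i\<in>I. \<phi> i x) has_derivative
     (\<lambda>y. \<Sum>i\<in>I. (grad (\<phi> i) x \<bullet> y) * (\<Prod>j\<in>I - {i}. \<phi> j x))) (at x)"
    by (intro has_derivative_prod has_derivative_grad assms)
  then show "(\<lambda>x. \<Prod>i\<in>I. \<phi> i x) differentiable (at x)"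
    unfolding differentiable_def by blast
  show "partial_deriv j (\<lambda>x. \<Prod>i\<in>I. \<phi> i x) x = (\<Sum>l\<in>I. partial_deriv j (\<phi> l) x * (\<Prod>i\<in>I - {l}. \<phi> i x))"
    by (subst partial_deriv_eqI[OF D]) (simp add: inner_axis)
qed

section \<open>A smooth bump function\<close>

text \<open>The power of \<open>t\<close> in the denominator makes the family closed under
  differentiation up to linear combinations, so one induction with \<open>m\<close> generalized
  gives smoothness of every member.\<close>

definition flat_exp :: "nat \<Rightarrow> real \<Rightarrow> real" where
  "flat_exp m t = (if t \<le> 0 then 0 else exp (- 1 / t) / t ^ m)"

lemma flat_exp_eq_0_iff: "flat_exp m t = 0 \<longleftrightarrow> t \<le> 0"
  by (auto simp: flat_exp_def)

lemma flat_exp_tendsto_0: "(flat_exp m \<longlongrightarrow> 0) (at 0)"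
proof -
  have "((\<lambda>s::real. s ^ m / exp s) \<longlongrightarrow> 0) at_top"
    by (rule tendsto_power_div_exp_0)
  then have "((\<lambda>t::real. inverse t ^ m / exp (inverse t)) \<longlongrightarrow> 0) (at_right 0)"
    using filterlim_inverse_at_top_right filterlim_compose by blast
  then have "(flat_exp m \<longlongrightarrow> 0) (at_right 0)"
  proof (rule Lim_transform_eventually)
    show "\<forall>\<^sub>F t in at_right 0. inverse t ^ m / exp (inverse t) = flat_exp m t"
      by (auto simp: eventually_at_filter flat_exp_def exp_minus field_simps power_inverse)
  qed
  moreover have "(flat_exp m \<longlongrightarrow> 0) (at_left 0)"
    by (rule Lim_transform_eventually[OF tendsto_const])
       (auto simp: eventually_at_filter flat_exp_def)
  ultimately show ?thesis by (simp add: filterlim_at_split)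
qed

lemma flat_exp_has_derivative:
  "(flat_exp m has_real_derivative flat_exp (m + 2) t - real m * flat_exp (m + 1) t) (at t)"
proof (rule linorder_cases[of t 0])
  assume "t < 0"
  then have "((\<lambda>t. 0) has_real_derivative flat_exp (m + 2) t - real m * flat_exp (m + 1) t) (at t)"
    by (simp add: flat_exp_def)
  then show ?thesis
    by (rule has_field_derivative_transform_within_open[where S="{..<0}"])
       (use \<open>t < 0\<close> in \<open>auto simp: flat_exp_def\<close>)
next
  assume "t > 0"
  then have "((\<lambda>t. exp (- 1 / t) / t ^ m) has_real_derivative flat_exp (m + 2) t - real m * flat_exp (m + 1) t) (at t)"
    by (auto intro!: derivative_eq_intros simp: flat_exp_def power2_eq_square)
       (cases m; simp add: field_simps power2_eq_square)
  then show ?thesis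
    by (rule has_field_derivative_transform_within_open[where S="{0<..}"])
       (use \<open>t > 0\<close> in \<open>auto simp: flat_exp_def\<close>)
next
  assume "t = 0"
  \<comment> \<open>At the origin the difference quotient of \<open>flat_exp m\<close> is
    \<open>flat_exp (Suc m)\<close>, which tends to \<open>0\<close>.\<close>
  have "((\<lambda>h. (flat_exp m (0 + h) - flat_exp m 0) / h) \<longlongrightarrow> 0) (at 0)"
    by (rule Lim_transform_eventually[OF flat_exp_tendsto_0[of "Suc m"]])
       (auto simp: eventually_at_filter flat_exp_def)
  then show ?thesis
    unfolding \<open>t = 0\<close> DERIV_def by (simp add: flat_exp_def)
qed

text \<open>For \<open>m = 0\<close> and \<open>r > 0\<close> this is the standard bump
  \<open>exp (-1 / (1 - |z - c|^2 / r^2))\<close> on the ball of radius \<open>r\<close>. Larger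
  \<open>m\<close> occur only in its derivatives.\<close>

definition bump :: "real ^ 'n::finite \<Rightarrow> real \<Rightarrow> nat \<Rightarrow> real ^ 'n \<Rightarrow> real" where
  "bump c r m z = flat_exp m (1 - (norm (z - c))\<^sup>2 / r\<^sup>2)"

lemma bump_has_derivative:
  "(bump c r m has_derivative
     (\<lambda>v. (bump c r (m + 2) z - real m * bump c r (m + 1) z) * (- 2 * ((z - c) \<bullet> v) / r\<^sup>2))) (at z)"
proof -
  have "((\<lambda>z. 1 - ((z - c) \<bullet> (z - c)) / r\<^sup>2) has_derivative (\<lambda>v. - 2 * ((z - c) \<bullet> v) / r\<^sup>2)) (at z)"
    by (auto intro!: derivative_eq_intros simp: inner_commute divide_inverse)
  then have "((\<lambda>z. 1 - (norm (z - c))\<^sup>2 / r\<^sup>2) has_derivative (\<lambda>v. - 2 * ((z - c) \<bullet> v) / r\<^sup>2)) (at z)"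
    by (simp only: power2_norm_eq_inner)
  from has_derivative_compose[OF this flat_exp_has_derivative[of m, unfolded has_field_derivative_def]]
  show ?thesis unfolding bump_def[abs_def] by (simp add: mult.commute)
qed

text \<open>Differences are written as sums with negated terms, so that \<open>C_k_add\<close>,
  \<open>C_k_mult\<close> and \<open>C_k_const\<close> apply to the right-hand side as it
  stands.\<close>

lemma partial_deriv_bump:
  "partial_deriv j (bump c r m) =
     (\<lambda>z. (- 2 / r\<^sup>2) * ((z $ j + - c $ j) * (bump c r (m + 2) z + (- real m) * bump c r (m + 1) z)))"
  by (rule ext, subst partial_deriv_eqI[OF bump_has_derivative]) (simp add: inner_axis divide_inverse algebra_simps)

lemma C_k_bump [simp]: "C_k k (bump c r m)"
proof (induction k arbitrary: m)
  case 0
  have "bump c r m differentiable at z" for z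
    using bump_has_derivative differentiable_def by blast
  then show ?case
    by (auto simp: continuous_on_eq_continuous_at differentiable_imp_continuous_within)
next
  case (Suc k)
  have "bump c r m differentiable at z" for z
    using bump_has_derivative differentiable_def by blast
  moreover have "C_k k (partial_deriv j (bump c r m))" for j
    unfolding partial_deriv_bump by (intro C_k_mult C_k_add C_k_const C_k_coord Suc)
  ultimately show ?case by simp
qed

text \<open>The null Lagrangian cancellation needs symmetric second derivatives. For mollified
  functions both derivatives fall on the kernel, so symmetry for the bump suffices, and there it is
  read off from the formula.\<close>

lemma partial_deriv_bump_commute:
  "partial_deriv i (partial_deriv j (bump c r m)) z = partial_deriv j (partial_deriv i (bump c r m)) z"
proof -
  let ?q = "\<lambda>z. bump c r (m + 2) z + (- real m) * bump c r (m + 1) z"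
  \<comment> \<open>\<open>?q\<close> is radial about \<open>c\<close>, so its gradient is a
    multiple of \<open>z - c\<close>; the multiplier \<open>s\<close> does not depend on
    \<open>i\<close>.\<close>
  obtain s where q': "partial_deriv i ?q z = (z $ i + - c $ i) * s" for i
  proof
    fix i
    have "partial_deriv i ?q z = partial_deriv i (bump c r (m + 2)) z + partial_deriv i (\<lambda>z. (- real m) * bump c r (m + 1) z) z"
      by (intro partial_deriv_add C_k_differentiable[of 0] C_k_bump C_k_mult C_k_const)
    also have "partial_deriv i (\<lambda>z. (- real m) * bump c r (m + 1) z) z
       = (- real m) * partial_deriv i (bump c r (m + 1)) z + partial_deriv i (\<lambda>z. - real m) z * bump c r (m + 1) z"
      by (intro partial_deriv_mult C_k_differentiable[of 0] C_k_bump C_k_const)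
    finally show "partial_deriv i ?q z = (z $ i + - c $ i) * ((- 2 / r\<^sup>2) * (bump c r (m + 2 + 2) z + (- real (m+2)) * bump c r (m + 2 + 1) z
      - real m * (bump c r (m + 1 + 2) z + (- real (m+1)) * bump c r (m + 1 + 1) z)))"
      unfolding partial_deriv_bump partial_deriv_const by (simp add: divide_inverse algebra_simps)
  qed
  have *: "partial_deriv i (partial_deriv j (bump c r m)) z =
     (- 2 / r\<^sup>2) * ((z $ j + - c $ j) * ((z $ i + - c $ i) * s) + (if j = i then 1 else 0) * ?q z)" for i j
  proof -
    have q: "?q differentiable at z"
      by (intro C_k_differentiable[of 0] C_k_bump C_k_mult C_k_add C_k_const)
    have l: "(\<lambda>z. z $ j + - c $ j) differentiable at z"
      by (intro C_k_differentiable[of 0] C_k_coord C_k_add C_k_const)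
    have l': "partial_deriv i (\<lambda>z. z $ j + - c $ j) z = (if j = i then 1 else 0)"
      by (subst partial_deriv_add) (auto intro!: C_k_differentiable[of 0] C_k_coord simp del: C_k.simps)
    have "partial_deriv i (partial_deriv j (bump c r m)) z = (- 2 / r\<^sup>2) * partial_deriv i (\<lambda>z. (z $ j + - c $ j) * ?q z) z"
      unfolding partial_deriv_bump[of j c r m]
      by (subst partial_deriv_mult[OF differentiable_const differentiable_mult[OF l q]]) simp
    also have "partial_deriv i (\<lambda>z. (z $ j + - c $ j) * ?q z) z = (z $ j + - c $ j) * ((z $ i + - c $ i) * s) + (if j = i then 1 else 0) * ?q z"
      unfolding partial_deriv_mult[OF l q] l' q' by simp
    finally show ?thesis .
  qed
  show ?thesis unfolding * by (auto simp: algebra_simps)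
qed

lemma bump_nonneg: "0 \<le> bump c r m z"
  by (simp add: bump_def flat_exp_def)

lemma bump_eq_0_iff:
  assumes "r > 0"
  shows "bump c r m z = 0 \<longleftrightarrow> r \<le> dist c z"
proof -
  have "bump c r m z = 0 \<longleftrightarrow> 1 \<le> (norm (z - c))\<^sup>2 / r\<^sup>2"
    by (simp add: bump_def flat_exp_eq_0_iff)
  also have "\<dots> \<longleftrightarrow> r\<^sup>2 \<le> (norm (z - c))\<^sup>2"
    using assms by (simp add: field_simps)
  also have "\<dots> \<longleftrightarrow> r \<le> dist c z"
    using assms by (simp add: power2_le_iff_abs_le dist_norm norm_minus_commute)
  finally show ?thesis .
qed

section \<open>Null Lagrangians for smooth maps\<close>

text \<open>Links the Bochner integral with the gauge integral, the one for which
  \<open>leibniz_rule\<close> is stated.\<close>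

lemma lborel_integral_compact_support:
  fixes f :: "'a::euclidean_space \<Rightarrow> real"
  assumes "continuous_on UNIV f" "compact S" "\<And>x. x \<notin> S \<Longrightarrow> f x = 0"
  shows "integrable lborel f" "integral\<^sup>L lborel f = integral S f"
proof -
  have eq: "(\<lambda>x. indicator S x *\<^sub>R f x) = f"
    using assms(3) by (auto simp: indicator_def fun_eq_iff)
  have I: "set_integrable lborel S f"
    unfolding set_integrable_def
    by (rule borel_integrable_compact) (use assms continuous_on_subset in blast)+
  then show "integrable lborel f"
    unfolding set_integrable_def eq .
  have "integral\<^sup>L lborel f = (LINT x:S|lborel. f x)"
    unfolding set_lebesgue_integral_def eq ..
  then show "integral\<^sup>L lborel f = integral S f"
    using set_borel_integral_eq_integral(2)[OF I] by simp
qed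

lemma partial_deriv_eq_0_open:
  assumes "open S" "x \<in> S" "\<And>y. y \<in> S \<Longrightarrow> \<phi> y = 0"
  shows "partial_deriv j \<phi> x = 0"
proof -
  have "(\<phi> has_derivative (\<lambda>v. 0)) (at x)"
    by (rule has_derivative_transform_within_open[where f="\<lambda>_. 0", OF _ assms(1,2)])
       (simp_all add: assms(3))
  then show ?thesis by (simp add: partial_deriv_eqI)
qed

lemma partial_deriv_eq_0_cball:
  assumes "\<And>z. z \<notin> cball c B \<Longrightarrow> K z = 0" "z \<notin> cball c B"
  shows "partial_deriv j K z = 0"
  by (rule partial_deriv_eq_0_open[where S="- cball c B"]) (use assms in auto)

section \<open>Correlation with a smooth kernel\<close>

text \<open>Correlation instead of convolution: for a kernel supported in \<open>[0, h]^N\<close> it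
  averages \<open>u\<close> over the cube with lower corner \<open>x\<close>, and
  \<open>y \<mapsto> K (y - x)\<close> is directly a test function for weak derivatives. The price
  is a minus sign with each derivative.\<close>

definition corr :: "(real ^ 'n::finite \<Rightarrow> real) \<Rightarrow> (real ^ 'n \<Rightarrow> real) \<Rightarrow> real ^ 'n \<Rightarrow> real" where
  "corr u K x = (LINT y|lborel. u y * K (y - x))"

text \<open>Differentiation under the integral sign: \<open>u\<close> is merely continuous, and
  \<open>x\<close> enters only through the kernel, so the derivative falls on
  \<open>K\<close>.\<close>

lemma corr_has_derivative:
  fixes K :: "real ^ 'n::finite \<Rightarrow> real"
  assumes u: "continuous_on UNIV u" and K: "C_k (Suc 0) K" and B: "\<And>z. z \<notin> cball 0 B \<Longrightarrow> K z = 0"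
  shows "(corr u K has_derivative (\<lambda>v. (\<chi> j. - corr u (partial_deriv j K) x) \<bullet> v)) (at x)"
proof -
  \<comment> \<open>The extra \<open>1\<close> gives one box that contains the supports of
    \<open>t \<mapsto> K (t - y)\<close> for all \<open>y\<close> in \<open>ball x 1\<close>;
    \<open>leibniz_rule\<close> needs a fixed domain of integration.\<close>
  obtain a where a: "cball x (B + 1) \<subseteq> cbox (-a) a"
    using bounded_subset_cbox_symmetric bounded_cball by blast
  have eq: "corr u K' y = integral (cbox (-a) a) (\<lambda>t. u t * K' (t - y))"
    if "continuous_on UNIV K'" "\<And>z. z \<notin> cball 0 B \<Longrightarrow> K' z = 0" "y \<in> ball x 1" for K' y
    unfolding corr_def
  proof (rule lborel_integral_compact_support)
    show "continuous_on UNIV (\<lambda>t. u t * K' (t - y))"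
      by (intro continuous_intros u continuous_on_compose2[OF that(1)]) auto
    show "u t * K' (t - y) = 0" if "t \<notin> cbox (- a) a" for t
    proof -
      have "t - y \<notin> cball 0 B"
      proof
        assume "t - y \<in> cball 0 B"
        then have "dist x t \<le> B + 1"
          using \<open>y \<in> ball x 1\<close> dist_triangle[of x t y] by (auto simp: dist_norm norm_minus_commute)
        with a that show False by auto
      qed
      then show ?thesis using \<open>\<And>z. z \<notin> cball 0 B \<Longrightarrow> K' z = 0\<close> by simp
    qed
  qed simp
  define w where "w y t = - u t *\<^sub>R grad K (t - y)" for y t
  have grad_cont: "continuous_on UNIV (grad K)"
    unfolding grad_def using K by (auto intro!: continuous_intros)
  have w_cont: "continuous_on (S \<times> T) (\<lambda>(y, t). w y t)" for S T
    unfolding w_def split_beta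
    by (intro continuous_intros continuous_on_compose2[OF u] continuous_on_compose2[OF grad_cont]) auto
  have "((\<lambda>y. integral (cbox (-a) a) (\<lambda>t. u t * K (t - y))) has_derivative
      blinfun_apply (integral (cbox (-a) a) (\<lambda>t. blinfun_inner_right (w x t)))) (at x within ball x 1)"
  proof (rule leibniz_rule)
    fix y t
    have "((\<lambda>y. u t * K (t - y)) has_derivative (\<lambda>v. u t * (grad K (t - y) \<bullet> (- v)))) (at y)"
      by (rule has_derivative_mult_right, rule has_derivative_compose[of "\<lambda>y. t - y" uminus])
         (use K in \<open>auto intro!: derivative_eq_intros has_derivative_grad\<close>)
    moreover have "(\<lambda>v. u t * (grad K (t - y) \<bullet> (- v))) = blinfun_apply (blinfun_inner_right (w y t))"
      by (simp add: w_def fun_eq_iff)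
    ultimately show "((\<lambda>y. u t * K (t - y)) has_derivative blinfun_apply (blinfun_inner_right (w y t))) (at y within ball x 1)"
      by (metis has_derivative_at_withinI)
  next
    fix y
    have "continuous_on (cbox (-a) a) (\<lambda>t. u t * K (t - y))"
      by (intro continuous_intros continuous_on_compose2[OF u] continuous_on_compose2[OF C_k_continuous[OF K]]) auto
    then show "(\<lambda>t. u t * K (t - y)) integrable_on cbox (-a) a"
      by (rule integrable_continuous)
  next
    show "continuous_on (ball x 1 \<times> cbox (- a) a) (\<lambda>(y, t). blinfun_inner_right (w y t))"
      using bounded_linear.continuous_on[OF bounded_linear_blinfun_inner_right w_cont]
      unfolding split_beta .
  qed auto
  moreover have "blinfun_apply (integral (cbox (-a) a) (\<lambda>t. blinfun_inner_right (w x t)))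
      = (\<lambda>v. (\<chi> j. - corr u (partial_deriv j K) x) \<bullet> v)"
  proof -
    have "continuous_on (cbox (-a) a) (w x)"
      unfolding w_def
      by (intro continuous_intros continuous_on_compose2[OF u] continuous_on_compose2[OF grad_cont]) auto
    then have wi: "w x integrable_on cbox (-a) a"
      by (rule integrable_continuous)
    have "integral (cbox (-a) a) (\<lambda>t. blinfun_inner_right (w x t)) = blinfun_inner_right (integral (cbox (-a) a) (w x))"
      using integral_linear[OF wi bounded_linear_blinfun_inner_right] by (simp add: o_def)
    moreover have "integral (cbox (-a) a) (w x) = (\<chi> j. - corr u (partial_deriv j K) x)"
    proof -
      have "integral (cbox (-a) a) (w x) $ j = - corr u (partial_deriv j K) x" for j
      proof -
        have "integral (cbox (-a) a) (w x) $ j = integral (cbox (-a) a) (\<lambda>t. w x t $ j)"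
          using integral_linear[OF wi bounded_linear_vec_nth[of j]] by (simp add: o_def)
        also have "\<dots> = integral (cbox (-a) a) (\<lambda>t. - (u t * partial_deriv j K (t - x)))"
          by (simp add: w_def)
        also have "\<dots> = - integral (cbox (-a) a) (\<lambda>t. u t * partial_deriv j K (t - x))"
          by (rule integral_neg)
        also have "\<dots> = - corr u (partial_deriv j K) x"
        proof -
          have P0: "partial_deriv j K z = 0" if "z \<notin> cball 0 B" for z
            using partial_deriv_eq_0_cball[of 0 B K z j] B that by blast
          have "continuous_on UNIV (partial_deriv j K)"
            using K by simp
          from eq[OF this P0, of x] show ?thesis by simp
        qed
        finally show ?thesis .
      qed
      then show ?thesis by (simp add: vec_eq_iff)
    qed
    ultimately show ?thesis by (simp add: fun_eq_iff)
  qed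
  ultimately have "((\<lambda>y. integral (cbox (-a) a) (\<lambda>t. u t * K (t - y))) has_derivative
       (\<lambda>v. (\<chi> j. - corr u (partial_deriv j K) x) \<bullet> v)) (at x within ball x 1)"
    by (simp only:)
  moreover have "at x within ball x 1 = at x"
    by (rule at_within_open) auto
  ultimately have "((\<lambda>y. integral (cbox (-a) a) (\<lambda>t. u t * K (t - y))) has_derivative
       (\<lambda>v. (\<chi> j. - corr u (partial_deriv j K) x) \<bullet> v)) (at x)"
    by (simp only:)
  then show ?thesis
  proof (rule has_derivative_transform_within_open[where s="ball x 1"])
    show "integral (cbox (-a) a) (\<lambda>t. u t * K (t - y)) = corr u K y" if "y \<in> ball x 1" for y
      using eq[OF C_k_continuous[OF K] _ that] B by metis
  qed auto
qed

lemma partial_deriv_corr: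
  assumes "continuous_on UNIV u" "C_k (Suc 0) K" "\<And>z. z \<notin> cball 0 B \<Longrightarrow> K z = 0"
  shows "partial_deriv j (corr u K) = (\<lambda>x. - corr u (partial_deriv j K) x)"
  by (rule ext, subst partial_deriv_eqI[OF corr_has_derivative[OF assms]]) (simp_all add: inner_axis)

lemma C_k_corr:
  assumes "continuous_on UNIV u" "C_k (Suc k) K" "\<And>z. z \<notin> cball 0 B \<Longrightarrow> K z = 0"
  shows "C_k k (corr u K)"
  using assms
proof (induction k arbitrary: K)
  case 0
  have "corr u K differentiable at x" for x
    using corr_has_derivative[OF 0(1,2,3)] differentiable_def by blast
  then show ?case
    by (auto simp: continuous_on_eq_continuous_at differentiable_imp_continuous_within)
next
  case (Suc k)
  have K: "C_k (Suc 0) K"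
    using Suc.prems(2) by (rule C_k_mono) simp
  have "corr u K differentiable at x" for x
    using corr_has_derivative[OF Suc.prems(1) K Suc.prems(3)] differentiable_def by blast
  moreover have "C_k k (partial_deriv j (corr u K))" for j
  proof -
    have "C_k k (corr u (partial_deriv j K))"
      using Suc.prems by (intro Suc.IH partial_deriv_eq_0_cball C_k_partial_deriv)
    then have "C_k k (\<lambda>x. (-1) * corr u (partial_deriv j K) x)"
      by (rule C_k_mult[OF C_k_const])
    then show ?thesis
      by (subst partial_deriv_corr[OF Suc.prems(1) K Suc.prems(3)]) simp_all
  qed
  ultimately show ?case by simp
qed

lemma integral_lborel_shift:
  fixes \<psi> :: "'a::euclidean_space \<Rightarrow> real"
  assumes [measurable]: "\<psi> \<in> borel_measurable borel"
  shows "(LINT y|lborel. \<psi> (y - x)) = (LINT y|lborel. \<psi> y)"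
proof -
  have "(LINT y|lborel. \<psi> y) = (LINT y|distr lborel borel ((+) (- x)). \<psi> y)"
    by (simp add: lborel_distr_plus)
  also have "\<dots> = (LINT y|lborel. \<psi> (- x + y))"
    by (rule integral_distr) auto
  finally show ?thesis by simp
qed

text \<open>The correlation of the constant \<open>1\<close> with \<open>\<phi>\<close> is constant
  by translation invariance, and its derivative, which is therefore \<open>0\<close>, is minus the
  integral of the partial derivative.\<close>

lemma integral_partial_deriv_eq_0:
  fixes \<phi> :: "real ^ 'n::finite \<Rightarrow> real"
  assumes "C_k (Suc 0) \<phi>" "\<And>z. z \<notin> cball 0 B \<Longrightarrow> \<phi> z = 0"
  shows "(LINT x|lborel. partial_deriv j \<phi> x) = 0"
proof -
  have [measurable]: "\<phi> \<in> borel_measurable borel"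
    using C_k_continuous[OF assms(1)] by (rule borel_measurable_continuous_onI)
  have "corr (\<lambda>x. 1) \<phi> = (\<lambda>x. LINT y|lborel. \<phi> y)"
    unfolding corr_def using integral_lborel_shift[of \<phi>] by auto
  then have "0 = partial_deriv j (corr (\<lambda>x. 1) \<phi>) 0"
    by simp
  also have "\<dots> = - corr (\<lambda>x. 1) (partial_deriv j \<phi>) 0"
    by (subst partial_deriv_corr[OF _ assms]) auto
  finally show ?thesis by (simp add: corr_def)
qed

section \<open>The determinant as a divergence\<close>

text \<open>The cofactors of the row of \<open>v\<close> form a divergence-free field (Piola
  identity). So the determinant is the signed sum over permutations of exact derivatives of
  compactly supported functions, and these integrate to \<open>0\<close>.\<close>

lemma integral_det_grad_eq_0:
  fixes g :: "'n::finite \<Rightarrow> real ^ 'n \<Rightarrow> real" and v :: "real ^ 'n \<Rightarrow> real"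
  assumes g: "\<And>i. C_k (Suc (Suc 0)) (g i)"
    and sym: "\<And>i j l x. partial_deriv j (partial_deriv l (g i)) x = partial_deriv l (partial_deriv j (g i)) x"
    and v: "C_k (Suc 0) v" and B: "\<And>z. z \<notin> cball 0 B \<Longrightarrow> v z = 0"
  shows "(LINT x|lborel. det (\<chi> i j. if i = k then partial_deriv j v x else partial_deriv j (g i) x)) = 0"
proof -
  let ?P = "{p. p permutes (UNIV::'n set)}"
  \<comment> \<open>In the derivative of \<open>u p\<close> the terms \<open>T x l p\<close> are
    those in which the factor of row \<open>l\<close> is differentiated a second time; they must
    cancel in the signed sum.\<close>
  define u where "u p x = v x * (\<Prod>i\<in>UNIV - {k}. partial_deriv (p i) (g i) x)" for p x
  define T where "T x l p = partial_deriv (p k) (partial_deriv (p l) (g l)) x *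
     (\<Prod>i\<in>UNIV - {k} - {l}. partial_deriv (p i) (g i) x)" for x l and p :: "'n \<Rightarrow> 'n"
  have diff_g: "partial_deriv j (g i) differentiable at x" for i j x
    using g by simp
  have u: "C_k (Suc 0) (u p)" for p
    unfolding u_def by (intro C_k_mult v C_k_prod C_k_partial_deriv g)
  have pu: "partial_deriv (p k) (u p) x =
      v x * (\<Sum>l\<in>UNIV - {k}. T x l p) + partial_deriv (p k) v x * (\<Prod>i\<in>UNIV - {k}. partial_deriv (p i) (g i) x)" for p x
    unfolding u_def T_def using v
    by (subst partial_deriv_mult) (auto intro!: partial_deriv_prod diff_g simp: partial_deriv_prod diff_g)
  \<comment> \<open>Composing \<open>p\<close> with the transposition of \<open>k\<close> and
    \<open>l\<close> reverses its sign and keeps \<open>T\<close> by symmetry of the second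
    derivatives, so the sum equals its own negative.\<close>
  have T0: "(\<Sum>p\<in>?P. of_int (sign p) * T x l p) = 0" if "l \<noteq> k" for x l
  proof -
    let ?t = "Transposition.transpose k l"
    have t: "?t permutes UNIV"
      by (simp add: permutes_swap_id)
    have "(\<Sum>p\<in>?P. of_int (sign p) * T x l p) = (\<Sum>p\<in>?P. of_int (sign (p \<circ> ?t)) * T x l (p \<circ> ?t))"
      by (rule sum_permutations_compose_right[OF t])
    also have "\<dots> = (\<Sum>p\<in>?P. - (of_int (sign p) * T x l p))"
    proof (rule sum.cong[OF refl])
      fix p assume "p \<in> ?P"
      then have "permutation p"
        using permutes_imp_permutation[of UNIV p] by simp
      then have s: "sign (p \<circ> ?t) = - sign p"
        using that by (simp add: sign_compose permutation_swap_id sign_swap_id)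
      have "(\<Prod>i\<in>UNIV - {k} - {l}. partial_deriv ((p \<circ> ?t) i) (g i) x) = (\<Prod>i\<in>UNIV - {k} - {l}. partial_deriv (p i) (g i) x)"
        by (rule prod.cong) auto
      then have "T x l (p \<circ> ?t) = T x l p"
        unfolding T_def using sym[of "p l" "p k" l x] by simp
      with s show "of_int (sign (p \<circ> ?t)) * T x l (p \<circ> ?t) = - (of_int (sign p) * T x l p)"
        by simp
    qed
    finally show ?thesis by (simp add: sum_negf)
  qed
  have det_eq: "det (\<chi> i j. if i = k then partial_deriv j v x else partial_deriv j (g i) x)
      = (\<Sum>p\<in>?P. of_int (sign p) * partial_deriv (p k) (u p) x)" for x
  proof -
    have "(\<Sum>p\<in>?P. of_int (sign p) * partial_deriv (p k) (u p) x)
       = v x * (\<Sum>l\<in>UNIV - {k}. \<Sum>p\<in>?P. of_int (sign p) * T x l p)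
         + (\<Sum>p\<in>?P. of_int (sign p) * (partial_deriv (p k) v x * (\<Prod>i\<in>UNIV - {k}. partial_deriv (p i) (g i) x)))"
      unfolding pu by (subst sum.swap) (simp add: sum_distrib_left sum.distrib algebra_simps)
    also have "(\<Sum>l\<in>UNIV - {k}. \<Sum>p\<in>?P. of_int (sign p) * T x l p) = 0"
      using T0 by (intro sum.neutral) auto
    finally show ?thesis
      unfolding det_def
      by (simp add: prod.remove[of UNIV k] cong: prod.cong_simp)
  qed
  have int: "integrable lborel (\<lambda>x. partial_deriv j (u p) x)" for p j
    by (rule lborel_integral_compact_support(1)[of _ "cball 0 B"])
       (use u partial_deriv_eq_0_cball[of 0 B "u p"] B in \<open>auto simp: u_def\<close>)
  have "(LINT x|lborel. (\<Sum>p\<in>?P. of_int (sign p) * partial_deriv (p k) (u p) x))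
     = (\<Sum>p\<in>?P. of_int (sign p) * (LINT x|lborel. partial_deriv (p k) (u p) x))"
    by (subst Bochner_Integration.integral_sum) (auto intro: int)
  also have "\<dots> = 0"
  proof -
    have "u p z = 0" if "z \<notin> cball 0 B" for p z
      using B[OF that] by (simp add: u_def)
    from integral_partial_deriv_eq_0[OF u this] show ?thesis by simp
  qed
  finally show ?thesis unfolding det_eq .
qed

lemma C_k_compose_real:
  fixes \<phi> :: "real ^ 'n::finite \<Rightarrow> real"
  assumes \<phi>: "C_k (Suc 0) \<phi>" and h: "\<And>t. (h has_real_derivative h' t) (at t)" "continuous_on UNIV h'"
  shows "C_k (Suc 0) (\<lambda>x. h (\<phi> x))"
    and "partial_deriv j (\<lambda>x. h (\<phi> x)) x = h' (\<phi> x) * partial_deriv j \<phi> x"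
proof -
  have D: "((\<lambda>x. h (\<phi> x)) has_derivative (\<lambda>v. h' (\<phi> x) * (grad \<phi> x \<bullet> v))) (at x)" for x
    using \<phi> by (intro has_derivative_compose[OF has_derivative_grad h(1)[unfolded has_field_derivative_def]]) auto
  have P: "partial_deriv j (\<lambda>x. h (\<phi> x)) x = h' (\<phi> x) * partial_deriv j \<phi> x" for j x
    by (subst partial_deriv_eqI[OF D]) (simp add: inner_axis)
  show "partial_deriv j (\<lambda>x. h (\<phi> x)) x = h' (\<phi> x) * partial_deriv j \<phi> x"
    by (rule P)
  have "continuous_on UNIV (partial_deriv j (\<lambda>x. h (\<phi> x)))" for j
    unfolding P[abs_def] using \<phi> C_k_continuous[OF \<phi>]
    by (auto intro!: continuous_intros continuous_on_compose2[OF h(2)])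
  then show "C_k (Suc 0) (\<lambda>x. h (\<phi> x))"
    using D by (auto simp: differentiable_def)
qed

text \<open>The open sets \<open>W\<close> and \<open>- C\<close> cover the space, and on each of
  them the cut-off function is visibly of class \<open>C^1\<close>.\<close>

lemma C_k_extend_0:
  fixes \<phi> :: "real ^ 'n::finite \<Rightarrow> real"
  assumes \<phi>: "C_k (Suc 0) \<phi>" and W: "open W" and C: "closed C" "C \<subseteq> W"
    and 0: "\<And>x. x \<in> W - C \<Longrightarrow> \<phi> x = 0"
  shows "C_k (Suc 0) (\<lambda>x. if x \<in> W then \<phi> x else 0)"
    and "x \<in> W \<Longrightarrow> partial_deriv j (\<lambda>x. if x \<in> W then \<phi> x else 0) x = partial_deriv j \<phi> x"
proof -
  let ?\<phi> = "\<lambda>x. if x \<in> W then \<phi> x else 0"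
  have D: "(?\<phi> has_derivative (\<lambda>v. grad \<phi> x \<bullet> v)) (at x)" if "x \<in> W" for x
    by (rule has_derivative_transform_within_open[OF has_derivative_grad W that]) (use \<phi> in auto)
  have D0: "(?\<phi> has_derivative (\<lambda>v. 0)) (at x)" if "x \<notin> C" for x
    by (rule has_derivative_transform_within_open[of "\<lambda>x. 0" _ _ _ "- C"])
       (use that C 0 in \<open>auto simp: open_Compl\<close>)
  have P: "partial_deriv j ?\<phi> x = partial_deriv j \<phi> x" if "x \<in> W" for x j
    by (subst partial_deriv_eqI[OF D[OF that]]) (simp add: inner_axis)
  then show "x \<in> W \<Longrightarrow> partial_deriv j ?\<phi> x = partial_deriv j \<phi> x" .
  have P0: "partial_deriv j ?\<phi> x = 0" if "x \<notin> C" for x j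
    by (subst partial_deriv_eqI[OF D0[OF that]]) simp
  have "continuous_on UNIV (partial_deriv j ?\<phi>)" for j
  proof -
    have "continuous_on W (partial_deriv j \<phi>)"
      using \<phi> continuous_on_subset[of UNIV "partial_deriv j \<phi>" W] by simp
    then have "continuous_on W (partial_deriv j ?\<phi>)"
      by (rule continuous_on_eq) (simp add: P)
    moreover have "continuous_on (- C) (partial_deriv j ?\<phi>)"
      by (rule continuous_on_eq[of _ "\<lambda>x. 0"]) (simp_all add: P0)
    ultimately have "continuous_on (W \<union> - C) (partial_deriv j ?\<phi>)"
      using W C by (intro continuous_on_open_Un) (auto simp: open_Compl)
    moreover have "W \<union> - C = UNIV"
      using C by auto
    ultimately show ?thesis by simp
  qed
  moreover have "?\<phi> differentiable at x" for x
    using D[of x] D0[of x] C unfolding differentiable_def by blast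
  ultimately show "C_k (Suc 0) ?\<phi>" by simp
qed

text \<open>The exponent \<open>m + 2\<close> leaves a positive exponent in the derivative, which
  keeps it continuous at the kink for every \<open>m\<close>.\<close>

lemma pos_part_power_has_derivative:
  "((\<lambda>t::real. max 0 t ^ (m + 2)) has_real_derivative real (m + 2) * max 0 t ^ (m + 1)) (at t)"
proof (rule linorder_cases[of t 0])
  assume "t < 0"
  then have "((\<lambda>t. 0) has_real_derivative real (m + 2) * max 0 t ^ (m + 1)) (at t)"
    by simp
  then show ?thesis
    by (rule has_field_derivative_transform_within_open[where S="{..<0}"])
       (use \<open>t < 0\<close> in auto)
next
  assume "t > 0"
  then have "((\<lambda>t. t ^ (m + 2)) has_real_derivative real (m + 2) * max 0 t ^ (m + 1)) (at t)"
    using DERIV_pow[of "m + 2" t] by simp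
  then show ?thesis
    by (rule has_field_derivative_transform_within_open[where S="{0<..}"])
       (use \<open>t > 0\<close> in auto)
next
  assume "t = 0"
  have "((\<lambda>h::real. max 0 h ^ (m + 1)) \<longlongrightarrow> max 0 0 ^ (m + 1)) (at 0)"
    by (intro tendsto_intros)
  then have "((\<lambda>h::real. max 0 h ^ (m + 1)) \<longlongrightarrow> 0) (at 0)"
    by simp
  then have "((\<lambda>h::real. (max 0 (0 + h) ^ (m + 2) - max 0 0 ^ (m + 2)) / h) \<longlongrightarrow> 0) (at 0)"
    by (rule Lim_transform_eventually) (auto simp: eventually_at_filter max_def)
  then show ?thesis
    unfolding \<open>t = 0\<close> DERIV_def by simp
qed

text \<open>The divergence of \<open>z \<mapsto> (\<rho>\<^sup>2 - |z - y|\<^sup>2)\<^sub>+ ^ (m + 2) * (z - y)\<close>.\<close>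

definition weight :: "nat \<Rightarrow> real \<Rightarrow> real ^ 'n::finite \<Rightarrow> real ^ 'n \<Rightarrow> real" where
  "weight m \<rho> y z = (let t = max 0 (\<rho>\<^sup>2 - (dist z y)\<^sup>2) in
     t ^ (m + 1) * (real CARD('n) * t - 2 * real (m + 2) * (dist z y)\<^sup>2))"

text \<open>Let \<open>v k\<close> be the \<open>k\<close>-th component of \<open>F(g)\<close>,
  where \<open>F\<close> is the field behind \<open>weight\<close>. Replacing row \<open>k\<close>
  of the Jacobian matrix by the gradient of \<open>v k\<close> multiplies the determinant by the
  \<open>k\<close>-th diagonal entry of the derivative of \<open>F\<close>. The sum over
  \<open>k\<close> gives the divergence, and each summand integrates to \<open>0\<close>.\<close>

lemma integral_weight_det_smooth:
  fixes g :: "'n::finite \<Rightarrow> real ^ 'n \<Rightarrow> real"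
  assumes g: "\<And>i. C_k (Suc (Suc 0)) (g i)"
    and sym: "\<And>i j l x. partial_deriv j (partial_deriv l (g i)) x = partial_deriv l (partial_deriv j (g i)) x"
    and W: "open W" and C: "compact C" "C \<subseteq> W" and "\<rho> > 0"
    and WC: "\<And>x. x \<in> W - C \<Longrightarrow> \<rho> \<le> dist (\<chi> i. g i x) y"
  shows "(LINT x|lborel. indicator C x * (weight m \<rho> y (\<chi> i. g i x) * det (\<chi> i j. partial_deriv j (g i) x))) = 0"
proof -
  define q where "q x = \<rho>\<^sup>2 + (\<Sum>i\<in>UNIV. (-1) * ((g i x + - y $ i) * (g i x + - y $ i)))" for x
  have dist_eq: "(dist (\<chi> i. g i x) y)\<^sup>2 = (\<Sum>i\<in>UNIV. (g i x + - y $ i) * (g i x + - y $ i))" for x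
    by (simp add: dist_norm norm_eq_sqrt_inner inner_vec_def sum_nonneg)
  have q_eq: "q x = \<rho>\<^sup>2 - (dist (\<chi> i. g i x) y)\<^sup>2" for x
    unfolding q_def dist_eq by (simp add: sum_negf)
  have g1: "C_k (Suc 0) (g i)" for i
    using g by (rule C_k_mono) simp
  have gd: "g i differentiable at x" for i x
    using g1 by simp
  have q: "C_k (Suc 0) q"
    unfolding q_def by (intro C_k_add C_k_sum C_k_mult C_k_const g1)
  have pq: "partial_deriv j q x = (\<Sum>i\<in>UNIV. - 2 * (g i x - y $ i) * partial_deriv j (g i) x)" for j x
  proof -
    have d: "((\<lambda>x. g i x + - y $ i) has_derivative (\<lambda>v. grad (g i) x \<bullet> v)) (at x)" for i
      by (auto intro!: derivative_eq_intros has_derivative_grad gd)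
    have "(q has_derivative (\<lambda>v. 0 + (\<Sum>i\<in>UNIV. (-1) * ((g i x + - y $ i) * (grad (g i) x \<bullet> v) + (grad (g i) x \<bullet> v) * (g i x + - y $ i))))) (at x)"
      unfolding q_def
      by (intro has_derivative_add has_derivative_const has_derivative_sum has_derivative_mult_right has_derivative_mult d)
    from partial_deriv_eqI[OF this, of j] show ?thesis
      by (simp add: inner_axis algebra_simps sum_distrib_left)
  qed
  define p where "p t = max 0 t ^ (m + 2)" for t :: real
  define p' where "p' t = real (m + 2) * max 0 t ^ (m + 1)" for t :: real
  have pd: "(p has_real_derivative p' t) (at t)" for t
    unfolding p_def p'_def by (rule pos_part_power_has_derivative)
  have "continuous_on UNIV p'"
    unfolding p'_def by (intro continuous_intros)
  note pq_comp = C_k_compose_real[OF q pd this]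
  have p0: "p (q x) = 0" if "x \<in> W - C" for x
  proof -
    have "\<rho>\<^sup>2 \<le> (dist (\<chi> i. g i x) y)\<^sup>2"
      using WC[OF that] \<open>\<rho> > 0\<close> by (intro power_mono) auto
    then show ?thesis by (simp add: p_def q_eq)
  qed
  \<comment> \<open>Outside \<open>W\<close> the map \<open>g\<close> may come close to
    \<open>y\<close> again, so the truncated profile has to be cut off there; the hypothesis on
    \<open>W - C\<close> makes the cut smooth.\<close>
  define T where "T x = (if x \<in> W then p (q x) else 0)" for x
  have T: "C_k (Suc 0) T"
    unfolding T_def by (rule C_k_extend_0[OF pq_comp(1) W compact_imp_closed[OF C(1)] C(2)]) (use p0 in auto)
  have pT: "partial_deriv j T x = p' (q x) * partial_deriv j q x" if "x \<in> W" for j x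
    unfolding T_def
    by (subst C_k_extend_0(2)[OF pq_comp(1) W compact_imp_closed[OF C(1)] C(2)]) (use p0 that pq_comp(2) in auto)
  have T0: "T x = 0" if "x \<notin> C" for x
    using p0 that by (auto simp: T_def)
  define v where "v k x = T x * (g k x + - y $ k)" for k x
  have v: "C_k (Suc 0) (v k)" for k
    unfolding v_def by (intro C_k_mult C_k_add C_k_const T g1)
  define M where "M x = (\<chi> i j. partial_deriv j (g i) x)" for x
  define R where "R k x = (\<chi> i j. if i = k then partial_deriv j (v k) x else partial_deriv j (g i) x)" for k x
  obtain B where B: "C \<subseteq> cball 0 B"
    using bounded_subset_ballD[OF compact_imp_bounded[OF C(1)], of 0] ball_subset_cball by (metis subset_trans)
  have v0: "v k x = 0" if "x \<notin> cball 0 B" for x k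
    using T0[of x] subsetD[OF B, of x] that by (cases "x \<in> C") (simp_all add: v_def)
  have int0: "(LINT x|lborel. det (R k x)) = 0" for k
    unfolding R_def by (rule integral_det_grad_eq_0[OF g sym v v0])
  have R_out: "det (R k x) = 0" if "x \<notin> C" for k x
  proof -
    have "partial_deriv j (v k) x = 0" for j
      by (rule partial_deriv_eq_0_open[of "- C"]) (use that C(1) T0 in \<open>auto simp: v_def compact_imp_closed open_Compl\<close>)
    then show ?thesis
      by (intro det_zero_row(2)[of k]) (simp add: row_def R_def vec_eq_iff)
  qed
  have R_in: "det (R k x) = (T x - 2 * p' (q x) * (g k x - y $ k)\<^sup>2) * det (M x)" if "x \<in> C" for k x
  proof -
    have xW: "x \<in> W" using that C by auto
    \<comment> \<open>By the chain rule the gradient of \<open>v k\<close> is the combination of the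
      rows of \<open>M x\<close> with coefficients \<open>w\<close>; Cramer's rule then singles out
      \<open>w $ k\<close>.\<close>
    define w :: "real ^ 'n" where "w = (\<chi> i. (if i = k then T x else 0) - 2 * p' (q x) * (g k x - y $ k) * (g i x - y $ i))"
    have "partial_deriv j (v k) x = (\<Sum>i\<in>UNIV. w $ i * partial_deriv j (g i) x)" for j
    proof -
      have "partial_deriv j (v k) x = T x * partial_deriv j (\<lambda>x. g k x + - y $ k) x + partial_deriv j T x * (g k x + - y $ k)"
        unfolding v_def by (rule partial_deriv_mult) (use T gd in auto)
      also have "partial_deriv j (\<lambda>x. g k x + - y $ k) x = partial_deriv j (g k) x"
        by (subst partial_deriv_add) (use gd in auto)
      also have "T x * partial_deriv j (g k) x + partial_deriv j T x * (g k x + - y $ k)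
           = T x * partial_deriv j (g k) x + (\<Sum>i\<in>UNIV. p' (q x) * (- 2 * (g i x - y $ i) * partial_deriv j (g i) x) * (g k x + - y $ k))"
        by (simp add: pT[OF xW] pq sum_distrib_left sum_distrib_right)
      also have "T x * partial_deriv j (g k) x = (\<Sum>i\<in>UNIV. (if i = k then T x else 0) * partial_deriv j (g i) x)"
        by (simp add: if_distrib[of "\<lambda>a. a * _"] cong: if_cong)
      also have "\<dots> + (\<Sum>i\<in>UNIV. p' (q x) * (- 2 * (g i x - y $ i) * partial_deriv j (g i) x) * (g k x + - y $ k))
          = (\<Sum>i\<in>UNIV. w $ i * partial_deriv j (g i) x)"
        by (subst sum.distrib[symmetric]) (auto intro!: sum.cong simp: w_def algebra_simps)
      finally show ?thesis .
    qed
    then have "R k x = (\<chi> i. if i = k then (\<Sum>i\<in>UNIV. w $ i *s row i (M x)) else row i (M x))"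
      by (auto simp: R_def M_def row_def vec_eq_iff)
    then have "det (R k x) = w $ k * det (M x)"
      by (simp only: cramer_lemma_transpose)
    then show ?thesis by (simp add: w_def power2_eq_square mult.assoc)
  qed
  have sum_eq: "(\<Sum>k\<in>UNIV. det (R k x)) = indicator C x * (weight m \<rho> y (\<chi> i. g i x) * det (M x))" for x
  proof (cases "x \<in> C")
    case True
    have "(\<Sum>k\<in>UNIV. det (R k x)) = (\<Sum>k\<in>UNIV. T x - 2 * p' (q x) * (g k x - y $ k)\<^sup>2) * det (M x)"
      by (simp add: R_in[OF True] sum_distrib_right)
    also have "(\<Sum>k\<in>UNIV. T x - 2 * p' (q x) * (g k x - y $ k)\<^sup>2) = real CARD('n) * T x - 2 * p' (q x) * (dist (\<chi> i. g i x) y)\<^sup>2"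
      unfolding dist_eq by (simp add: sum_subtractf sum_distrib_left[symmetric] power2_eq_square)
    also have "\<dots> = weight m \<rho> y (\<chi> i. g i x)"
      using True C by (auto simp: T_def p_def p'_def weight_def Let_def q_eq algebra_simps)
    finally show ?thesis using True by simp
  next
    case False
    then show ?thesis by (simp add: R_out)
  qed
  have "integrable lborel (\<lambda>x. det (R k x))" for k
  proof (rule lborel_integral_compact_support(1)[OF _ C(1)])
    show "continuous_on UNIV (\<lambda>x. det (R k x))"
    proof -
      have R_cont: "continuous_on UNIV (\<lambda>x. R k x $ i $ j)" for i j
        using v[of k] g1[of i] by (cases "i = k") (simp_all add: R_def)
      then show ?thesis
        unfolding det_def
        by (intro continuous_on_sum continuous_on_mult continuous_on_const continuous_on_prod R_cont)
    qed
  qed (rule R_out)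
  then have "(LINT x|lborel. (\<Sum>k\<in>UNIV. det (R k x))) = (\<Sum>k\<in>UNIV. LINT x|lborel. det (R k x))"
    by (intro Bochner_Integration.integral_sum)
  then show ?thesis
    unfolding sum_eq int0 M_def by simp
qed

section \<open>Mollification\<close>

lemma scaleR_One_eq_vec: "h *\<^sub>R (One :: real ^ 'n::finite) = vec h"
proof -
  have "One \<bullet> (axis i 1 :: real ^ 'n) = 1" for i
    by (rule inner_sum_left_Basis[of _ "\<lambda>_. 1", simplified]) (auto simp: axis_in_Basis_iff)
  then have "(One :: real ^ 'n) $ i = 1" for i
    by (simp only: inner_axis inner_real_def mult_1_right)
  then show ?thesis
    by (simp only: vec_eq_iff vector_scaleR_component vec_component real_scaleR_def mult_1_right simp_thms)
qed

lemma integrable_bump: "r > 0 \<Longrightarrow> integrable lborel (bump c r m)"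
  by (rule lborel_integral_compact_support(1)[of _ "cball c r"])
     (auto simp: bump_eq_0_iff C_k_continuous[OF C_k_bump])

text \<open>On the ball of half the radius the argument of \<open>flat_exp\<close> is at least
  \<open>3 / 4\<close>, so the bump is at least \<open>exp (- (4 / 3))\<close> there. This controls
  the normalizing factor of the mollifier.\<close>

lemma integral_bump_ge:
  fixes c :: "real ^ 'n::finite"
  assumes "r > 0"
  shows "exp (- (4 / 3)) * (unit_ball_vol CARD('n) * (r / 2) ^ CARD('n)) \<le> integral\<^sup>L lborel (bump c r 0)"
proof -
  have "exp (- (4 / 3)) * (unit_ball_vol CARD('n) * (r / 2) ^ CARD('n)) = (LINT x|lborel. indicator (ball c (r / 2)) x * exp (- (4 / 3) :: real))"
    using content_ball[of "r / 2" c] assms by simp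
  also have "\<dots> \<le> integral\<^sup>L lborel (bump c r 0)"
  proof (rule integral_mono)
    show "integrable lborel (\<lambda>x. indicator (ball c (r / 2)) x * exp (- (4 / 3) :: real))"
    proof -
      have "integrable lborel (indicator (ball c (r / 2)) :: real ^ 'n \<Rightarrow> real)"
        by (intro integrable_real_indicator emeasure_bounded_finite) auto
      then show ?thesis by (rule integrable_mult_left)
    qed
    show "integrable lborel (bump c r 0)"
      using assms by (rule integrable_bump)
    fix x
    show "indicator (ball c (r / 2)) x * exp (- (4 / 3) :: real) \<le> bump c r 0 x"
    proof (cases "x \<in> ball c (r / 2)")
      case True
      then have "(norm (x - c))\<^sup>2 \<le> (r / 2)\<^sup>2"
        by (intro power_mono) (auto simp: dist_norm norm_minus_commute)
      then have t: "3 / 4 \<le> 1 - (norm (x - c))\<^sup>2 / r\<^sup>2" (is "_ \<le> ?t")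
        using assms by (simp add: field_simps)
      then have "1 / ?t \<le> 4 / 3"
        by (simp add: field_simps)
      then have "exp (- (4 / 3)) \<le> exp (- 1 / ?t)"
        by (simp del: divide_le_eq)
      moreover have "bump c r 0 x = exp (- 1 / ?t)"
      proof -
        have "\<not> ?t \<le> 0"
          using t by linarith
        then show ?thesis
          by (simp only: bump_def flat_exp_def if_False power_0 div_by_1)
      qed
      ultimately show ?thesis
        using True by simp
    qed (simp add: bump_nonneg)
  qed
  finally show ?thesis .
qed

text \<open>The mollifier sits in the corner cube \<open>[0, h]\<^sup>N\<close> instead of a ball around the origin
  because the Lebesgue points of \<open>integrable_ccontinuous_explicit\<close> are stated for such cubes.\<close>

definition moll :: "real \<Rightarrow> real ^ 'n::finite \<Rightarrow> real" where
  "moll h z = (1 / integral\<^sup>L lborel (bump (vec (h / 2) :: real ^ 'n) (h / 2) 0)) * bump (vec (h / 2)) (h / 2) 0 z"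

lemma integral_bump_pos:
  fixes c :: "real ^ 'n::finite"
  assumes "r > 0"
  shows "integral\<^sup>L lborel (bump c r 0) > 0"
proof -
  have "0 < exp (- (4 / 3)) * (unit_ball_vol CARD('n) * (r / 2) ^ CARD('n))"
    using assms by simp
  with integral_bump_ge[OF assms, of c] show ?thesis by linarith
qed

lemma C_k_moll: "C_k k (moll h)"
  unfolding moll_def[abs_def] by (intro C_k_mult C_k_const C_k_bump)

lemma moll_measurable [measurable]: "moll h \<in> borel_measurable borel"
  by (intro borel_measurable_continuous_onI C_k_continuous[OF C_k_moll])

lemma partial_deriv_cmult:
  "C_k (Suc 0) \<phi> \<Longrightarrow> partial_deriv j (\<lambda>x. a * \<phi> x) = (\<lambda>x. a * partial_deriv j \<phi> x)"
  by (rule ext, subst partial_deriv_mult) auto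

lemma partial_deriv_moll_commute:
  "partial_deriv i (partial_deriv j (moll h)) z = partial_deriv j (partial_deriv i (moll h)) z"
proof -
  have C: "C_k (Suc 0) (partial_deriv j (bump c r m))" for c :: "real ^ 'n::finite" and j r m
    by (intro C_k_partial_deriv C_k_bump)
  show ?thesis
    unfolding moll_def[abs_def] partial_deriv_cmult[OF C_k_bump] partial_deriv_cmult[OF C]
    by (simp only: partial_deriv_bump_commute[of i j])
qed

lemma moll_nonneg: "h > 0 \<Longrightarrow> 0 \<le> moll h (z :: real ^ 'n::finite)"
  unfolding moll_def using integral_bump_pos[of "h / 2" "vec (h / 2) :: real ^ 'n"]
  by (intro mult_nonneg_nonneg bump_nonneg) (simp add: less_imp_le)

lemma ball_subset_cube:
  "ball (vec (h / 2) :: real ^ 'n::finite) (h / 2) \<subseteq> cbox 0 (vec h)"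
proof
  fix z :: "real ^ 'n"
  assume "z \<in> ball (vec (h / 2)) (h / 2)"
  then have "\<bar>(vec (h / 2) - z) $ i\<bar> < h / 2" for i
    using component_le_norm_cart[of "vec (h / 2) - z" i] by (auto simp: dist_norm)
  then have "\<bar>h / 2 - z $ i\<bar> < h / 2" for i
    by simp
  then show "z \<in> cbox 0 (vec h)"
    by (auto simp: mem_box_cart abs_less_iff) (smt (verit) field_sum_of_halves)+
qed

lemma moll_eq_0:
  fixes z :: "real ^ 'n::finite"
  assumes "h > 0" "z \<notin> cbox 0 (vec h)"
  shows "moll h z = 0"
proof -
  have "z \<notin> ball (vec (h / 2)) (h / 2)"
    using ball_subset_cube assms(2) by blast
  then show ?thesis
    using assms(1) by (simp add: moll_def bump_eq_0_iff)
qed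

lemma moll_shift_eq_0:
  fixes x :: "real ^ 'n::finite"
  assumes "h > 0" "y \<notin> cbox x (x + vec h)"
  shows "moll h (y - x) = 0"
proof (rule moll_eq_0[OF assms(1)])
  show "y - x \<notin> cbox 0 (vec h)"
  proof
    assume *: "y - x \<in> cbox 0 (vec h)"
    have "x $ i \<le> y $ i \<and> y $ i \<le> x $ i + h" for i
      using *[unfolded mem_box_cart, rule_format, of i] by simp
    with assms(2) show False
      by (simp add: mem_box_cart)
  qed
qed

text \<open>The crude bound of the norm by the sum of the coordinates; the factor
  \<open>CARD('n)\<close> reappears in every later restriction on \<open>h\<close>.\<close>

lemma cube_subset_cball: "h \<ge> 0 \<Longrightarrow> cbox x (x + vec h) \<subseteq> cball x (real CARD('n) * h)"
  for x :: "real ^ 'n::finite"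
proof
  fix y :: "real ^ 'n"
  assume "h \<ge> 0" and y: "y \<in> cbox x (x + vec h)"
  have "dist x y \<le> (\<Sum>i\<in>UNIV. \<bar>(x - y) $ i\<bar>)"
    unfolding dist_norm by (rule norm_le_l1_cart)
  also have "\<dots> \<le> (\<Sum>i\<in>(UNIV::'n set). h)"
    using y by (intro sum_mono) (auto simp: mem_box_cart abs_le_iff algebra_simps)
  finally show "y \<in> cball x (real CARD('n) * h)"
    by simp
qed

lemma moll_eq_0_cball: "h > 0 \<Longrightarrow> z \<notin> cball 0 (real CARD('n) * h) \<Longrightarrow> moll h (z :: real ^ 'n::finite) = 0"
  using moll_eq_0[of h z] subsetD[OF cube_subset_cball[of h "0 :: real ^ 'n"], of z]
  by (cases "z \<in> cbox 0 (vec h)") simp_all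

lemma integral_moll: "h > 0 \<Longrightarrow> integral\<^sup>L lborel (moll h :: real ^ 'n::finite \<Rightarrow> real) = 1"
  unfolding moll_def[abs_def] using integral_bump_pos[of "h / 2" "vec (h / 2) :: real ^ 'n"] by simp

lemma moll_shift_integrable:
  assumes "h > 0"
  shows "integrable lborel (\<lambda>y. moll h (y - x))"
proof (rule lborel_integral_compact_support(1))
  show "continuous_on UNIV (\<lambda>y. moll h (y - x))"
    by (intro continuous_on_compose2[OF C_k_continuous[OF C_k_moll]] continuous_intros) auto
  show "y \<notin> cbox x (x + vec h) \<Longrightarrow> moll h (y - x) = 0" for y
    by (rule moll_shift_eq_0[OF assms])
qed auto

lemma moll_shift_integral: "h > 0 \<Longrightarrow> (LINT y|lborel. moll h (y - x)) = 1"
  by (subst integral_lborel_shift) (auto simp: integral_moll)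

text \<open>The reciprocal of the lower bound in \<open>integral_bump_ge\<close> for radius
  \<open>h / 2\<close>, with \<open>h ^ n\<close> split off; the half-radius ball has radius
  \<open>h / 4\<close>, whence \<open>4 ^ n\<close>.\<close>

definition moll_bound :: "nat \<Rightarrow> real" where
  "moll_bound n = exp (4 / 3) * 4 ^ n / unit_ball_vol n"

lemma moll_le:
  assumes "h > 0"
  shows "moll h (z :: real ^ 'n::finite) \<le> moll_bound CARD('n) / h ^ CARD('n)"
proof -
  let ?c = "vec (h / 2) :: real ^ 'n"
  let ?I = "integral\<^sup>L lborel (bump ?c (h / 2) 0)"
  have b: "bump ?c (h / 2) 0 z \<le> 1"
    by (auto simp: bump_def flat_exp_def)
  have "exp (- (4 / 3)) * (unit_ball_vol CARD('n) * (h / 4) ^ CARD('n)) \<le> ?I"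
    using integral_bump_ge[of "h / 2" ?c] assms by simp
  moreover have "0 < exp (- (4 / 3)) * (unit_ball_vol CARD('n) * (h / 4) ^ CARD('n))"
    using assms by simp
  ultimately have "1 / ?I \<le> 1 / (exp (- (4 / 3)) * (unit_ball_vol CARD('n) * (h / 4) ^ CARD('n)))"
    by (intro divide_left_mono mult_pos_pos[of ?I]) auto
  also have "\<dots> = moll_bound CARD('n) / h ^ CARD('n)"
    by (simp add: moll_bound_def exp_minus power_divide field_simps)
  finally have "1 / ?I \<le> moll_bound CARD('n) / h ^ CARD('n)" .
  moreover have "moll h z \<le> 1 / ?I"
    unfolding moll_def using b integral_bump_pos[of "h / 2" ?c] assms by (simp add: divide_right_mono)
  ultimately show ?thesis by linarith
qed

lemma moll_bound_nonneg: "0 \<le> moll_bound n"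
  by (simp add: moll_bound_def)

lemma integrable_mult_moll:
  fixes V :: "real ^ 'n::finite \<Rightarrow> real"
  assumes "h > 0" "set_integrable lborel (cbox x (x + vec h)) V"
    and [measurable]: "V \<in> borel_measurable borel"
  shows "integrable lborel (\<lambda>y. V y * moll h (y - x))"
proof (rule Bochner_Integration.integrable_bound)
  let ?b = "moll_bound CARD('n) / h ^ CARD('n)"
  show "integrable lborel (\<lambda>y. ?b * (indicator (cbox x (x + vec h)) y *\<^sub>R V y))"
    using assms(2) unfolding set_integrable_def by (rule integrable_mult_right)
  show "AE y in lborel. norm (V y * moll h (y - x)) \<le> norm (?b * (indicator (cbox x (x + vec h)) y *\<^sub>R V y))"
  proof (rule AE_I2)
    fix y
    show "norm (V y * moll h (y - x)) \<le> norm (?b * (indicator (cbox x (x + vec h)) y *\<^sub>R V y))"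
    proof (cases "y \<in> cbox x (x + vec h)")
      case True
      have "moll h (y - x) * \<bar>V y\<bar> \<le> ?b * \<bar>V y\<bar>"
        by (intro mult_right_mono moll_le assms) auto
      then show ?thesis
        using True moll_nonneg[OF assms(1), of "y - x"] moll_bound_nonneg[of "CARD('n)"] assms(1)
        by (simp add: abs_mult mult.commute)
    qed (simp add: moll_shift_eq_0[OF assms(1)])
  qed
qed measurable

section \<open>Convergence of mollifications\<close>

text \<open>The mollifier has integral \<open>1\<close> and is at most \<open>moll_bound\<close>
  over the volume of the cube, so a mollification differs from any constant by at most a fixed
  multiple of a mean over the cube. This reduces convergence to Lebesgue points.\<close>

lemma corr_moll_diff_le:
  fixes V :: "real ^ 'n::finite \<Rightarrow> real"
  assumes h: "h > 0" and V: "set_integrable lborel (cbox x (x + vec h)) V"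
    and [measurable]: "V \<in> borel_measurable borel"
  shows "\<bar>corr V (moll h) x - a\<bar> \<le>
     moll_bound CARD('n) * (integral (cbox x (x + vec h)) (\<lambda>y. \<bar>V y - a\<bar>) / h ^ CARD('n))"
proof -
  let ?Q = "cbox x (x + vec h)"
  let ?b = "moll_bound CARD('n) / h ^ CARD('n)"
  have c: "set_integrable lborel ?Q (\<lambda>y. a)"
    unfolding set_integrable_def by (intro borel_integrable_compact) auto
  have Va: "set_integrable lborel ?Q (\<lambda>y. V y - a)"
    using V c by (rule set_integral_diff)
  have abs_int: "set_integrable lborel ?Q (\<lambda>y. \<bar>V y - a\<bar>)"
    using Va by (rule set_integrable_abs)
  have "corr V (moll h) x - a = (LINT y|lborel. V y * moll h (y - x)) - (LINT y|lborel. a * moll h (y - x))"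
    using moll_shift_integral[OF h, of x] by (simp add: corr_def)
  also have "\<dots> = (LINT y|lborel. (V y - a) * moll h (y - x))"
    by (subst Bochner_Integration.integral_diff[symmetric])
       (auto intro!: integrable_mult_moll[OF h V] integrable_mult_right moll_shift_integrable[OF h] simp: left_diff_distrib)
  finally have "\<bar>corr V (moll h) x - a\<bar> \<le> (LINT y|lborel. \<bar>(V y - a) * moll h (y - x)\<bar>)"
    using integral_abs_bound by metis
  also have "\<dots> \<le> (LINT y|lborel. ?b * (indicator ?Q y *\<^sub>R \<bar>V y - a\<bar>))"
  proof (rule integral_mono)
    show "integrable lborel (\<lambda>y. \<bar>(V y - a) * moll h (y - x)\<bar>)"
      by (intro integrable_abs integrable_mult_moll[OF h Va]) auto
    show "integrable lborel (\<lambda>y. ?b * (indicator ?Q y *\<^sub>R \<bar>V y - a\<bar>))"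
      using abs_int unfolding set_integrable_def by (rule integrable_mult_right)
    fix y
    show "\<bar>(V y - a) * moll h (y - x)\<bar> \<le> ?b * (indicator ?Q y *\<^sub>R \<bar>V y - a\<bar>)"
    proof (cases "y \<in> ?Q")
      case True
      have "moll h (y - x) * \<bar>V y - a\<bar> \<le> ?b * \<bar>V y - a\<bar>"
        by (intro mult_right_mono moll_le h) auto
      then show ?thesis
        using True moll_nonneg[OF h, of "y - x"] by (simp add: abs_mult mult.commute)
    qed (simp add: moll_shift_eq_0[OF h])
  qed
  also have "\<dots> = ?b * (LINT y:?Q|lborel. \<bar>V y - a\<bar>)"
    by (simp add: set_lebesgue_integral_def)
  also have "(LINT y:?Q|lborel. \<bar>V y - a\<bar>) = integral ?Q (\<lambda>y. \<bar>V y - a\<bar>)"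
    by (rule set_borel_integral_eq_integral(2)[OF abs_int])
  finally show ?thesis by simp
qed

lemma integrable_imp_set_integrable:
  fixes V :: "'a::euclidean_space \<Rightarrow> real"
  assumes "integrable lborel V" "S \<in> sets borel"
  shows "set_integrable lborel S V"
  unfolding set_integrable_def using assms by (intro integrable_mult_indicator) auto

text \<open>At almost every point the means of \<open>|V - q|\<close> over shrinking cubes tend to
  \<open>|V x - q|\<close> for all rational \<open>q\<close> at once; a rational \<open>q\<close>
  close to \<open>V x\<close> makes the right side of \<open>corr_moll_diff_le\<close>
  small.\<close>

lemma corr_moll_tendsto_AE:
  fixes V :: "real ^ 'n::finite \<Rightarrow> real"
  assumes V: "integrable lborel V"
  shows "AE x in lborel. ((\<lambda>h. corr V (moll h) x) \<longlongrightarrow> V x) (at_right 0)"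
proof -
  have [measurable]: "V \<in> borel_measurable borel"
    using V by auto
  have int: "(\<lambda>y. \<bar>V y - q\<bar>) integrable_on cbox a b" for a b q
  proof -
    have "set_integrable lborel (cbox a b) (\<lambda>y. q)"
      unfolding set_integrable_def by (intro borel_integrable_compact) auto
    from set_integral_diff(1)[OF integrable_imp_set_integrable[OF V] this]
    have "set_integrable lborel (cbox a b) (\<lambda>y. \<bar>V y - q\<bar>)"
      by (intro set_integrable_abs) auto
    then show ?thesis
      by (rule set_borel_integral_eq_integral(1))
  qed
  have "\<exists>N. negligible N \<and> (\<forall>x e. x \<notin> N \<longrightarrow> 0 < e \<longrightarrow> (\<exists>d>0. \<forall>h. 0 < h \<and> h < d \<longrightarrow>
      \<bar>integral (cbox x (x + vec h)) (\<lambda>y. \<bar>V y - q\<bar>) / h ^ CARD('n) - \<bar>V x - q\<bar>\<bar> < e))" for q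
    using integrable_ccontinuous_explicit[OF int[of q]]
    by (simp only: scaleR_One_eq_vec DIM_cart DIM_real mult_1_right real_norm_def divideR_right real_scaleR_def)
       (metis (no_types, lifting) divide_inverse_commute)
  then obtain N where N: "\<And>q. negligible (N q)"
    and Np: "\<And>q x e. x \<notin> N q \<Longrightarrow> 0 < e \<Longrightarrow> \<exists>d>0. \<forall>h. 0 < h \<and> h < d \<longrightarrow>
      \<bar>integral (cbox x (x + vec h)) (\<lambda>y. \<bar>V y - q\<bar>) / h ^ CARD('n) - \<bar>V x - q\<bar>\<bar> < e"
    by metis
  \<comment> \<open>The exceptional set depends on \<open>q\<close>; restricting to rational
    \<open>q\<close> keeps the union negligible.\<close>
  have "negligible (\<Union>q\<in>\<rat>. N q)"
    using N by (intro negligible_countable_Union) (auto simp: countable_rat)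
  then have "AE x in lebesgue. x \<notin> (\<Union>q\<in>\<rat>. N q)"
    by (intro AE_not_in) (simp add: negligible_iff_null_sets)
  then have "AE x in lborel. x \<notin> (\<Union>q\<in>\<rat>. N q)"
    by (simp only: AE_completion_iff)
  then show ?thesis
  proof (rule AE_mp, intro AE_I2 impI tendstoI)
    fix x and e :: real
    assume x: "x \<notin> (\<Union>q\<in>\<rat>. N q)" and "e > 0"
    let ?B = "moll_bound CARD('n)"
    \<comment> \<open>The total error is below \<open>2 * ?B * e'\<close> for the distance of the
      mollification to \<open>q\<close>, plus \<open>e'\<close> for that of \<open>q\<close> to
      \<open>V x\<close>.\<close>
    define e' where "e' = e / (2 * ?B + 2)"
    have B: "0 \<le> ?B" by (rule moll_bound_nonneg)
    then have e': "e' > 0" "2 * ?B * e' + e' < e"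
      using \<open>e > 0\<close> by (auto simp: e'_def field_simps add_pos_nonneg)
    obtain q where q: "q \<in> \<rat>" "\<bar>V x - q\<bar> < e'"
    proof -
      obtain q where "q \<in> \<rat>" "V x < q" "q < V x + e'"
        using Rats_dense_in_real[of "V x" "V x + e'"] e' by auto
      then show ?thesis by (intro that[of q]) auto
    qed
    obtain d where d: "d > 0" "\<And>h. 0 < h \<Longrightarrow> h < d \<Longrightarrow>
        \<bar>integral (cbox x (x + vec h)) (\<lambda>y. \<bar>V y - q\<bar>) / h ^ CARD('n) - \<bar>V x - q\<bar>\<bar> < e'"
      using Np[of x q e'] x q e' by auto
    have "dist (corr V (moll h) x) (V x) < e" if "0 < h" "h < d" for h
    proof -
      have "\<bar>corr V (moll h) x - q\<bar> \<le> ?B * (integral (cbox x (x + vec h)) (\<lambda>y. \<bar>V y - q\<bar>) / h ^ CARD('n))"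
        by (intro corr_moll_diff_le integrable_imp_set_integrable V that) auto
      also have "\<dots> \<le> ?B * (2 * e')"
        using d(2)[OF that] q by (intro mult_left_mono B) linarith
      finally show ?thesis
        using q(2) e'(2) by (simp add: dist_real_def)
    qed
    then show "\<forall>\<^sub>F h in at_right 0. dist (corr V (moll h) x) (V x) < e"
      unfolding eventually_at_right_field using d(1) by auto
  qed
qed

lemma corr_moll_close:
  fixes U :: "real ^ 'n::finite \<Rightarrow> real"
  assumes U: "continuous_on UNIV U" and h: "h > 0"
    and e: "\<And>y. y \<in> cbox x (x + vec h) \<Longrightarrow> \<bar>U y - U x\<bar> \<le> e"
  shows "\<bar>corr U (moll h) x - U x\<bar> \<le> moll_bound CARD('n) * e"
proof -
  let ?Q = "cbox x (x + vec h)"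
  have Q: "?Q \<noteq> {}"
    using h by (auto simp: interval_ne_empty_cart)
  have "integral ?Q (\<lambda>y. \<bar>U y - U x\<bar>) \<le> integral ?Q (\<lambda>y. e)"
    by (intro integral_le e integrable_continuous continuous_intros continuous_on_subset[OF U]) auto
  also have "\<dots> = e * h ^ CARD('n)"
    using content_cbox_cart[OF Q] by simp
  finally have "integral ?Q (\<lambda>y. \<bar>U y - U x\<bar>) / h ^ CARD('n) \<le> e"
    using h by (simp add: field_simps)
  moreover have "\<bar>corr U (moll h) x - U x\<bar> \<le> moll_bound CARD('n) * (integral ?Q (\<lambda>y. \<bar>U y - U x\<bar>) / h ^ CARD('n))"
  proof (intro corr_moll_diff_le h borel_measurable_continuous_onI U)
    show "set_integrable lborel ?Q U"
      unfolding set_integrable_def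
      by (intro borel_integrable_compact continuous_on_subset[OF U]) auto
  qed
  ultimately show ?thesis
    using mult_left_mono[OF _ moll_bound_nonneg[of "CARD('n)"]] by (meson order_trans)
qed

text \<open>Jensen's inequality for the probability density \<open>moll h (y - x)\<close> and the
  convex function \<open>t ^ n\<close>. It supplies the majorants for the mollified
  determinants.\<close>

lemma corr_moll_power_le:
  fixes V :: "real ^ 'n::finite \<Rightarrow> real"
  assumes h: "h > 0" and V: "integrable lborel V" and Vn: "integrable lborel (\<lambda>x. \<bar>V x\<bar> ^ n)" and "n > 0"
  shows "\<bar>corr V (moll h) x\<bar> ^ n \<le> corr (\<lambda>x. \<bar>V x\<bar> ^ n) (moll h) x"
proof -
  have [measurable]: "V \<in> borel_measurable borel"
    using V by auto
  have int: "integrable lborel (\<lambda>y. W y * moll h (y - x))" if "integrable lborel W" for W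
    using that by (intro integrable_mult_moll h integrable_imp_set_integrable) auto
  define s where "s = corr (\<lambda>x. \<bar>V x\<bar>) (moll h) x"
  have s: "\<bar>corr V (moll h) x\<bar> \<le> s"
  proof -
    have "\<bar>corr V (moll h) x\<bar> \<le> (LINT y|lborel. \<bar>V y * moll h (y - x)\<bar>)"
      unfolding corr_def by (rule integral_abs_bound)
    also have "\<dots> = s"
      unfolding s_def corr_def by (simp add: abs_mult moll_nonneg[OF h])
    finally show ?thesis .
  qed
  show ?thesis
  proof (cases "s = 0")
    case True
    have "0 \<le> corr (\<lambda>x. \<bar>V x\<bar> ^ n) (moll h) x"
      unfolding corr_def by (intro integral_nonneg_AE AE_I2 mult_nonneg_nonneg moll_nonneg h) auto
    with True s \<open>n > 0\<close> show ?thesis by (simp add: zero_power)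
  next
    case False
    then have "s > 0" using s by linarith
    \<comment> \<open>The tangent line of \<open>t ^ n\<close> at \<open>s\<close> lies below the
      graph, by Bernoulli's inequality for \<open>t / s\<close>. Integrated against the mollifier at
      \<open>t = |V y|\<close>, it takes the value \<open>s ^ n\<close>.\<close>
    have tangent: "s ^ n * (1 - real n) + (real n * s ^ n / s) * t \<le> t ^ n" if "t \<ge> 0" for t
    proof -
      have "1 + real n * (t / s - 1) \<le> (1 + (t / s - 1)) ^ n"
        using that \<open>s > 0\<close> by (intro Bernoulli_inequality) auto
      then have "s ^ n * (1 + real n * (t / s - 1)) \<le> s ^ n * (1 + (t / s - 1)) ^ n"
        using \<open>s > 0\<close> by (intro mult_left_mono) auto
      also have "s ^ n * (1 + (t / s - 1)) ^ n = t ^ n"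
        using \<open>s > 0\<close> by (simp add: power_divide)
      finally show ?thesis by (simp add: algebra_simps)
    qed
    have "s ^ n = s ^ n * (1 - real n) + (real n * s ^ n / s) * s"
      using \<open>s > 0\<close> by (simp add: algebra_simps)
    also have "\<dots> = (LINT y|lborel. s ^ n * (1 - real n) * moll h (y - x)) + (LINT y|lborel. (real n * s ^ n / s) * (\<bar>V y\<bar> * moll h (y - x)))"
      using moll_shift_integral[OF h, of x] by (simp add: s_def corr_def)
    also have "\<dots> = (LINT y|lborel. s ^ n * (1 - real n) * moll h (y - x) + (real n * s ^ n / s) * (\<bar>V y\<bar> * moll h (y - x)))"
      by (intro Bochner_Integration.integral_add[symmetric] integrable_mult_right int integrable_abs V moll_shift_integrable h)
    also have "\<dots> \<le> corr (\<lambda>x. \<bar>V x\<bar> ^ n) (moll h) x"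
      unfolding corr_def
    proof (intro integral_mono Bochner_Integration.integrable_add integrable_mult_right int integrable_abs V Vn moll_shift_integrable h)
      fix y
      show "s ^ n * (1 - real n) * moll h (y - x) + (real n * s ^ n / s) * (\<bar>V y\<bar> * moll h (y - x)) \<le> \<bar>V y\<bar> ^ n * moll h (y - x)"
        using mult_right_mono[OF tangent[of "\<bar>V y\<bar>"] moll_nonneg[OF h, of "y - x"]] by (simp add: algebra_simps)
    qed
    finally have "s ^ n \<le> corr (\<lambda>x. \<bar>V x\<bar> ^ n) (moll h) x" .
    moreover have "\<bar>corr V (moll h) x\<bar> ^ n \<le> s ^ n"
      using s by (intro power_mono) auto
    ultimately show ?thesis by linarith
  qed
qed

lemma corr_measurable [measurable]:
  assumes [measurable]: "V \<in> borel_measurable borel" "K \<in> borel_measurable borel"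
  shows "corr V K \<in> borel_measurable borel"
  unfolding corr_def[abs_def] by measurable

text \<open>By Tonelli it is enough that the mollifier also has integral \<open>1\<close> in
  \<open>x\<close>, which follows from the invariance of Lebesgue measure under the reflection
  \<open>x \<mapsto> y - x\<close>. Preservation of mass is what makes the varying majorants
  converge in mean.\<close>

lemma nn_integral_corr_moll:
  fixes w :: "real ^ 'n::finite \<Rightarrow> real"
  assumes h: "h > 0" and w: "integrable lborel w" "\<And>x. w x \<ge> 0"
  shows "(\<integral>\<^sup>+x. ennreal (corr w (moll h) x) \<partial>lborel) = (\<integral>\<^sup>+x. ennreal (w x) \<partial>lborel)"
proof -
  have [measurable]: "w \<in> borel_measurable borel"
    using w by auto
  have 1: "(\<integral>\<^sup>+x. ennreal (moll h (y - x)) \<partial>lborel) = 1" for y :: "real ^ 'n"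
  proof -
    have "lborel = density (distr lborel borel (\<lambda>x. y + (-1) *\<^sub>R x)) (\<lambda>_. \<bar>-1 :: real\<bar> ^ DIM(real ^ 'n))"
      by (rule lborel_affine) simp
    then have "(\<integral>\<^sup>+x. ennreal (moll h (x - 0 :: real ^ 'n)) \<partial>lborel) =
        (\<integral>\<^sup>+x. ennreal (moll h (x - 0 :: real ^ 'n)) \<partial>density (distr lborel borel (\<lambda>x. y + (-1) *\<^sub>R x)) (\<lambda>_. \<bar>-1 :: real\<bar> ^ DIM(real ^ 'n)))"
      by (rule arg_cong[where f = "\<lambda>M. \<integral>\<^sup>+x. ennreal (moll h (x - 0 :: real ^ 'n)) \<partial>M"])
    also have "\<dots> = (\<integral>\<^sup>+x. ennreal (moll h (y - x)) \<partial>lborel)"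
      by (simp add: nn_integral_density nn_integral_distr)
    finally have "(\<integral>\<^sup>+x. ennreal (moll h (y - x)) \<partial>lborel) = (\<integral>\<^sup>+x. ennreal (moll h (x - 0 :: real ^ 'n)) \<partial>lborel)" ..
    also have "\<dots> = ennreal 1"
      using moll_shift_integrable[OF h, of 0] moll_shift_integral[OF h, of 0] moll_nonneg[OF h]
      by (subst nn_integral_eq_integral) auto
    finally show ?thesis by simp
  qed
  have "(\<integral>\<^sup>+x. ennreal (corr w (moll h) x) \<partial>lborel) = (\<integral>\<^sup>+x. \<integral>\<^sup>+y. ennreal (w y * moll h (y - x)) \<partial>lborel \<partial>lborel)"
    unfolding corr_def
    by (intro nn_integral_cong nn_integral_eq_integral[symmetric] integrable_mult_moll h integrable_imp_set_integrable w AE_I2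
          mult_nonneg_nonneg moll_nonneg) auto
  also have "\<dots> = (\<integral>\<^sup>+y. \<integral>\<^sup>+x. ennreal (w y * moll h (y - x)) \<partial>lborel \<partial>lborel)"
    by (rule lborel_pair.Fubini') measurable
  also have "\<dots> = (\<integral>\<^sup>+y. ennreal (w y) * (\<integral>\<^sup>+x. ennreal (moll h (y - x)) \<partial>lborel) \<partial>lborel)"
    by (simp add: ennreal_mult w moll_nonneg[OF h] nn_integral_cmult)
  finally show ?thesis by (simp add: 1)
qed

text \<open>Dominated convergence with moving majorants. Pointwise convergence and the bound on
  their integrals make the \<open>w n\<close> converge to \<open>W\<close> in mean (Scheffe), so the
  fixed function \<open>W\<close> can serve as majorant up to a vanishing error.\<close>

lemma integral_tendsto_dominated_sequence:
  fixes g :: "nat \<Rightarrow> 'a \<Rightarrow> real"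
  assumes [measurable]: "\<And>n. g n \<in> borel_measurable M" "G \<in> borel_measurable M" "\<And>n. w n \<in> borel_measurable M"
    and W: "integrable M W"
    and g: "AE x in M. (\<lambda>n. g n x) \<longlonglongrightarrow> G x" and w: "AE x in M. (\<lambda>n. w n x) \<longlonglongrightarrow> W x"
    and le: "\<And>n x. \<bar>g n x\<bar> \<le> w n x"
    and nn: "\<And>n. (\<integral>\<^sup>+x. ennreal (w n x) \<partial>M) \<le> (\<integral>\<^sup>+x. ennreal (W x) \<partial>M)"
  shows "integrable M G \<and> (\<lambda>n. integral\<^sup>L M (g n)) \<longlonglongrightarrow> integral\<^sup>L M G"
proof -
  have [measurable]: "W \<in> borel_measurable M"
    using W by auto
  have w_nonneg: "0 \<le> w n x" for n x
    using le[of n x] by linarith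
  have W_nonneg: "AE x in M. 0 \<le> W x"
    using w by (rule AE_mp) (auto intro!: AE_I2 tendsto_lowerbound[where F=sequentially] simp: w_nonneg)
  have W_abs: "(\<integral>\<^sup>+x. ennreal (W x) \<partial>M) = (\<integral>\<^sup>+x. ennreal (norm (W x)) \<partial>M)"
    using W_nonneg by (intro nn_integral_cong_AE) auto
  have wi: "integrable M (w n)" for n
  proof (rule integrableI_bounded)
    have "(\<integral>\<^sup>+x. ennreal (norm (w n x)) \<partial>M) \<le> (\<integral>\<^sup>+x. ennreal (norm (W x)) \<partial>M)"
      using nn[of n] w_nonneg by (simp add: W_abs)
    also have "\<dots> < \<infinity>"
      using W by (simp add: integrable_iff_bounded)
    finally show "(\<integral>\<^sup>+x. ennreal (norm (w n x)) \<partial>M) < \<infinity>" .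
  qed measurable
  have wW: "(\<lambda>n. \<integral>\<^sup>+x. norm (w n x - W x) \<partial>M) \<longlonglongrightarrow> 0"
    by (rule Scheffe_lemma2) (use W w nn w_nonneg W_abs in auto)
  have wW': "(\<lambda>n. LINT x|M. \<bar>w n x - W x\<bar>) \<longlonglongrightarrow> 0"
  proof -
    have "(\<integral>\<^sup>+x. norm (w n x - W x) \<partial>M) = ennreal (LINT x|M. \<bar>w n x - W x\<bar>)" for n
      using nn_integral_eq_integral[of M "\<lambda>x. \<bar>w n x - W x\<bar>"] wi W by auto
    with wW have "(\<lambda>n. ennreal (LINT x|M. \<bar>w n x - W x\<bar>)) \<longlonglongrightarrow> ennreal 0"
      by simp
    then show ?thesis
      by (subst (asm) tendsto_ennreal_iff) auto
  qed
  \<comment> \<open>Truncation at height \<open>|W|\<close> gives a sequence with a fixed majorant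
    and the same limit; since \<open>|g n| \<le> w n\<close>, what is cut off is at most
    \<open>|w n - W|\<close>.\<close>
  define g' where "g' n x = max (- \<bar>W x\<bar>) (min \<bar>W x\<bar> (g n x))" for n x
  have g'_lim: "AE x in M. (\<lambda>n. g' n x) \<longlonglongrightarrow> G x"
    using g w
  proof (eventually_elim)
    fix x
    assume 1: "(\<lambda>n. g n x) \<longlonglongrightarrow> G x" and 2: "(\<lambda>n. w n x) \<longlonglongrightarrow> W x"
    have "(\<lambda>n. g' n x) \<longlonglongrightarrow> max (- \<bar>W x\<bar>) (min \<bar>W x\<bar> (G x))"
      unfolding g'_def by (intro tendsto_intros 1)
    moreover have "\<bar>G x\<bar> \<le> W x"
      by (rule LIMSEQ_le[OF tendsto_rabs[OF 1] 2]) (use le in auto)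
    then have "max (- \<bar>W x\<bar>) (min \<bar>W x\<bar> (G x)) = G x"
      by linarith
    ultimately show "(\<lambda>n. g' n x) \<longlonglongrightarrow> G x" by simp
  qed
  have [measurable]: "g' n \<in> borel_measurable M" for n
    unfolding g'_def by measurable
  have bound: "AE x in M. norm (g' n x) \<le> \<bar>W x\<bar>" for n
    by (rule AE_I2) (auto simp: g'_def)
  have Gi: "integrable M G"
    by (rule integrable_dominated_convergence[OF _ _ _ g'_lim bound]) (use W in auto)
  have g'_int: "integrable M (g' n)" for n
    by (rule integrable_dominated_convergence2[OF _ _ _ g'_lim bound]) (use W in auto)
  have lim: "(\<lambda>n. integral\<^sup>L M (g' n)) \<longlonglongrightarrow> integral\<^sup>L M G"
    by (rule integral_dominated_convergence[OF _ _ _ g'_lim bound]) (use W in auto)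
  have gi: "integrable M (g n)" for n
    by (rule Bochner_Integration.integrable_bound[OF wi[of n]]) (use le w_nonneg in auto)
  have "(\<lambda>n. integral\<^sup>L M (g n) - integral\<^sup>L M (g' n)) \<longlonglongrightarrow> 0"
  proof (rule tendsto_rabs_zero_cancel, rule tendsto_sandwich[OF _ _ tendsto_const wW'])
    show "\<forall>\<^sub>F n in sequentially. 0 \<le> \<bar>integral\<^sup>L M (g n) - integral\<^sup>L M (g' n)\<bar>"
      by simp
    have "\<bar>integral\<^sup>L M (g n) - integral\<^sup>L M (g' n)\<bar> \<le> (LINT x|M. \<bar>w n x - W x\<bar>)" for n
    proof -
      have "\<bar>integral\<^sup>L M (g n) - integral\<^sup>L M (g' n)\<bar> = \<bar>LINT x|M. g n x - g' n x\<bar>"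
        using gi g'_int by simp
      also have "\<dots> \<le> (LINT x|M. \<bar>g n x - g' n x\<bar>)"
        by (rule integral_abs_bound)
      also have "\<dots> \<le> (LINT x|M. \<bar>w n x - W x\<bar>)"
      proof (rule integral_mono)
        show "\<bar>g n x - g' n x\<bar> \<le> \<bar>w n x - W x\<bar>" for x
          using le[of n x] by (auto simp: g'_def)
      qed (use gi g'_int wi W in auto)
      finally show ?thesis .
    qed
    then show "\<forall>\<^sub>F n in sequentially. \<bar>integral\<^sup>L M (g n) - integral\<^sup>L M (g' n)\<bar> \<le> (LINT x|M. \<bar>w n x - W x\<bar>)"
      by simp
  qed
  from tendsto_add[OF this lim] Gi show ?thesis
    by simp
qed

section \<open>Weak derivatives under mollification\<close>

lemma has_derivative_shift:
  fixes \<phi> :: "real ^ 'n::finite \<Rightarrow> real"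
  assumes "\<phi> differentiable at (y - x)"
  shows "((\<lambda>y. \<phi> (y - x)) has_derivative (\<lambda>v. grad \<phi> (y - x) \<bullet> v)) (at y)"
proof -
  have "((\<lambda>y. y - x) has_derivative (\<lambda>v. v)) (at y)"
    by (auto intro!: derivative_eq_intros)
  from has_derivative_compose[OF this has_derivative_grad[OF assms]] show ?thesis .
qed

lemma partial_deriv_shift:
  assumes "\<phi> differentiable at (y - x)"
  shows "partial_deriv j (\<lambda>y. \<phi> (y - x)) y = partial_deriv j \<phi> (y - x)"
  by (subst partial_deriv_eqI[OF has_derivative_shift[OF assms]]) (simp add: inner_axis)

lemma C_k_shift: "C_k k \<phi> \<Longrightarrow> C_k k (\<lambda>y. \<phi> (y - x))"
proof (induction k arbitrary: \<phi>)
  case 0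
  then show ?case
    by (auto intro!: continuous_on_compose2[of UNIV \<phi>] continuous_intros)
next
  case (Suc k)
  have "partial_deriv j (\<lambda>y. \<phi> (y - x)) = (\<lambda>y. partial_deriv j \<phi> (y - x))" for j
    using Suc.prems by (intro ext partial_deriv_shift) auto
  moreover have "(\<lambda>y. \<phi> (y - x)) differentiable at y" for y
    using has_derivative_shift[OF C_k_differentiable[OF Suc.prems]] differentiable_def by blast
  ultimately show ?case
    using Suc by auto
qed

lemma lebesgue_on_integral_eq_lborel:
  fixes F :: "'a::euclidean_space \<Rightarrow> real"
  assumes "G \<in> sets borel" "F \<in> borel_measurable borel" "\<And>x. x \<notin> G \<Longrightarrow> F x = 0"
  shows "(LINT x|lebesgue_on G. F x) = (LINT x|lborel. F x)"
proof -
  have "(LINT x|lebesgue_on G. F x) = (LINT x|lebesgue. indicator G x *\<^sub>R F x)"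
    using assms by (intro integral_restrict_space) auto
  also have "(\<lambda>x. indicator G x *\<^sub>R F x) = F"
    using assms(3) by (auto simp: indicator_def fun_eq_iff)
  also have "(LINT x|lebesgue. F x) = (LINT x|lborel. F x)"
    using assms by (intro integral_completion) auto
  finally show ?thesis .
qed

text \<open>The translate \<open>y \<mapsto> moll h (y - x)\<close> is a test function in
  \<open>G\<close>, its support lying in the cube inside \<open>A\<close>. Inserting it into the
  definition of the weak derivative gives the claim; \<open>U\<close> and \<open>V\<close> are
  globally defined substitutes whose values off \<open>A\<close> never enter.\<close>

lemma partial_deriv_corr_moll:
  fixes u v :: "real ^ 'n::finite \<Rightarrow> real"
  assumes G: "open G" and weak: "weak_partial_deriv j G u v" and v: "v \<in> borel_measurable (lebesgue_on G)"
    and A: "A \<subseteq> G" and U: "continuous_on UNIV U" "\<And>y. y \<in> A \<Longrightarrow> U y = u y"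
    and V: "V \<in> borel_measurable borel" "AE y in lborel. y \<in> A \<longrightarrow> V y = v y"
    and h: "h > 0" and Q: "cbox x (x + vec h) \<subseteq> A"
  shows "partial_deriv j (corr U (moll h)) x = corr V (moll h) x"
proof -
  let ?Q = "cbox x (x + vec h)"
  define \<phi> where "\<phi> y = moll h (y - x)" for y
  have \<phi>0: "\<phi> y = 0" if "y \<notin> ?Q" for y
    unfolding \<phi>_def by (rule moll_shift_eq_0[OF h that])
  have C: "C_k k \<phi>" for k
    unfolding \<phi>_def[abs_def] by (intro C_k_shift C_k_moll)
  have p\<phi>: "partial_deriv j \<phi> = (\<lambda>y. partial_deriv j (moll h) (y - x))"
    unfolding \<phi>_def[abs_def] by (intro ext partial_deriv_shift C_k_differentiable[OF C_k_moll])
  have p\<phi>0: "partial_deriv j \<phi> y = 0" if "y \<notin> ?Q" for y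
    by (rule partial_deriv_eq_0_open[of "- ?Q"]) (use that \<phi>0 in auto)
  have supp: "closure {y. \<phi> y \<noteq> 0} \<subseteq> ?Q"
    using \<phi>0 by (intro closure_minimal) auto
  have "bounded {y. \<phi> y \<noteq> 0}"
    using \<phi>0 by (intro bounded_subset[OF bounded_cbox[of x "x + vec h"]]) auto
  then have test: "test_function G \<phi>"
    unfolding test_function_def using C supp Q A by auto
  have Um [measurable]: "U \<in> borel_measurable borel"
    using U(1) by (rule borel_measurable_continuous_onI)
  have [measurable]: "\<phi> \<in> borel_measurable borel"
    using C_k_continuous[OF C[of 0]] by (rule borel_measurable_continuous_onI)
  have [measurable]: "partial_deriv j \<phi> \<in> borel_measurable borel"
    using C_k_continuous[OF C_k_partial_deriv[OF C[of "Suc 0"]]] by (rule borel_measurable_continuous_onI)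
  have [measurable]: "G \<in> sets borel" "V \<in> borel_measurable borel"
    using G V by auto
  have QG: "?Q \<subseteq> G"
    using Q A by blast
  have "corr V (moll h) x = (LINT y|lborel. V y * \<phi> y)"
    by (simp add: corr_def \<phi>_def)
  also have "\<dots> = (LINT y|lebesgue_on G. V y * \<phi> y)"
  proof (rule lebesgue_on_integral_eq_lborel[symmetric])
    show "V y * \<phi> y = 0" if "y \<notin> G" for y
      using \<phi>0[of y] QG that by auto
  qed measurable
  also have "\<dots> = (LINT y|lebesgue_on G. v y * \<phi> y)"
  proof (rule integral_cong_AE)
    show "(\<lambda>y. V y * \<phi> y) \<in> borel_measurable (lebesgue_on G)"
      by (intro borel_measurable_times measurable_restrict_space1 measurable_completion) auto
    show "(\<lambda>y. v y * \<phi> y) \<in> borel_measurable (lebesgue_on G)"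
      by (intro borel_measurable_times v measurable_restrict_space1 measurable_completion) auto
    have "AE y in lebesgue. y \<in> A \<longrightarrow> V y = v y"
      using V(2) by (rule AE_completion)
    then have "AE y in lebesgue. y \<in> G \<longrightarrow> V y * \<phi> y = v y * \<phi> y"
      by eventually_elim (use \<phi>0 Q in force)
    then show "AE y in lebesgue_on G. V y * \<phi> y = v y * \<phi> y"
      by (subst AE_restrict_space_iff) auto
  qed
  also have "\<dots> = - (LINT y|lebesgue_on G. u y * partial_deriv j \<phi> y)"
    using weak test unfolding weak_partial_deriv_def by simp
  also have "(LINT y|lebesgue_on G. u y * partial_deriv j \<phi> y) = (LINT y|lebesgue_on G. U y * partial_deriv j \<phi> y)"
    by (intro Bochner_Integration.integral_cong refl) (use p\<phi>0 U(2) Q in force)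
  also have "\<dots> = (LINT y|lborel. U y * partial_deriv j \<phi> y)"
  proof (rule lebesgue_on_integral_eq_lborel)
    show "U y * partial_deriv j \<phi> y = 0" if "y \<notin> G" for y
      using p\<phi>0[of y] QG that by auto
  qed measurable
  also have "\<dots> = corr U (partial_deriv j (moll h)) x"
    by (simp add: corr_def p\<phi>)
  finally show ?thesis
    by (subst partial_deriv_corr[OF U(1) C_k_moll moll_eq_0_cball[OF h]]) simp_all
qed

text \<open>Each derivative passes to the kernel with a minus sign; the two signs cancel and the
  symmetry of \<open>K\<close> remains.\<close>

lemma partial_deriv_corr_commute:
  assumes u: "continuous_on UNIV u" and K: "\<And>k. C_k k K" and B: "\<And>z. z \<notin> cball 0 B \<Longrightarrow> K z = 0"
    and sym: "\<And>z. partial_deriv i (partial_deriv j K) z = partial_deriv j (partial_deriv i K) z"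
  shows "partial_deriv i (partial_deriv j (corr u K)) x = partial_deriv j (partial_deriv i (corr u K)) x"
proof -
  have K1: "C_k (Suc 0) K" "C_k (Suc 0) (partial_deriv l K)" for l
    by (rule K) (rule C_k_partial_deriv[OF K])
  have 1: "partial_deriv l (corr u K) = (\<lambda>x. (-1) * corr u (partial_deriv l K) x)" for l
    using partial_deriv_corr[OF u K1(1) B] by simp
  have P0: "partial_deriv l K z = 0" if "z \<notin> cball 0 B" for l z
    using partial_deriv_eq_0_cball[of 0 B K z l] B that by blast
  have 2: "partial_deriv k (partial_deriv l (corr u K)) = corr u (partial_deriv k (partial_deriv l K))" for k l
  proof -
    have "C_k (Suc 0) (corr u (partial_deriv l K))"
      by (rule C_k_corr[OF u C_k_partial_deriv[OF K] P0])
    then have "partial_deriv k (partial_deriv l (corr u K)) = (\<lambda>x. (-1) * partial_deriv k (corr u (partial_deriv l K)) x)"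
      unfolding 1 by (rule partial_deriv_cmult)
    also have "partial_deriv k (corr u (partial_deriv l K)) = (\<lambda>x. - corr u (partial_deriv k (partial_deriv l K)) x)"
      by (rule partial_deriv_corr[OF u K1(2) P0])
    finally show ?thesis by simp
  qed
  have "partial_deriv i (partial_deriv j K) = partial_deriv j (partial_deriv i K)"
    using sym by blast
  then show ?thesis
    unfolding 2 by (rule arg_cong)
qed

text \<open>Extension of \<open>v\<close> from \<open>A\<close> by zero and a change on a null set
  yield a Borel function integrable over the whole space, to which Tonelli's theorem and the results
  on mollification apply.\<close>

lemma L_loc_borel_version:
  fixes v :: "real ^ 'n::finite \<Rightarrow> real"
  assumes v: "L_loc p G v" and p: "p > 0" and A: "compact A" "A \<subseteq> G"
  obtains V where "V \<in> borel_measurable borel" "integrable lborel V" "integrable lborel (\<lambda>x. \<bar>V x\<bar> ^ p)"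
    "AE x in lborel. x \<in> A \<longrightarrow> V x = v x"
proof -
  have A_sets: "A \<in> sets borel" "A \<in> sets lebesgue"
    using borel_compact[OF A(1)] by auto
  define g where "g x = (if x \<in> A then v x else 0)" for x
  have gm: "g \<in> borel_measurable lebesgue"
    unfolding g_def
  proof (rule borel_measurable_if_I[OF _ A_sets(2)])
    show "v \<in> borel_measurable (lebesgue_on A)"
      using measurable_restrict_mono[OF conjunct1[OF v[unfolded L_loc_def]] A(2)] .
  qed
  then obtain V where V: "V \<in> borel_measurable lborel" and ae: "AE x in lborel. g x = V x"
    using completion_ex_borel_measurable_real by blast
  have [measurable]: "V \<in> borel_measurable borel"
    using V by simp
  have "integrable (lebesgue_on A) (\<lambda>x. \<bar>v x\<bar> ^ p)"
    using v A by (auto simp: L_loc_def)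
  then have "integrable lebesgue (\<lambda>x. indicator A x *\<^sub>R \<bar>v x\<bar> ^ p)"
    using A_sets by (subst (asm) integrable_restrict_space) auto
  also have "(\<lambda>x. indicator A x *\<^sub>R \<bar>v x\<bar> ^ p) = (\<lambda>x. \<bar>g x\<bar> ^ p)"
    using p by (auto simp: g_def indicator_def zero_power)
  finally have "integrable lebesgue (\<lambda>x. \<bar>g x\<bar> ^ p)" .
  moreover have "AE x in lebesgue. \<bar>g x\<bar> ^ p = \<bar>V x\<bar> ^ p"
    using AE_completion[OF ae] by eventually_elim simp
  moreover have "V \<in> borel_measurable lebesgue"
    using V by (rule measurable_completion)
  ultimately have "integrable lebesgue (\<lambda>x. \<bar>V x\<bar> ^ p)"
    using gm by (subst (asm) integrable_cong_AE) auto
  then have Vp: "integrable lborel (\<lambda>x. \<bar>V x\<bar> ^ p)"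
    by (subst (asm) integrable_completion) auto
  \<comment> \<open>On \<open>A\<close> one has \<open>|V| \<le> 1 + |V|^p\<close>, and off
    \<open>A\<close> the function is zero almost everywhere, so integrability of the power and
    finite volume of \<open>A\<close> give integrability of \<open>V\<close>.\<close>
  have "integrable lborel (\<lambda>x. indicator A x + \<bar>V x\<bar> ^ p)"
    using A(1) by (intro Bochner_Integration.integrable_add Vp integrable_real_indicator emeasure_bounded_finite)
      (auto simp: A_sets compact_imp_bounded)
  moreover have "AE x in lborel. norm (V x) \<le> norm (indicator A x + \<bar>V x\<bar> ^ p)"
    using ae
  proof eventually_elim
    fix x
    assume x: "g x = V x"
    show "norm (V x) \<le> norm (indicator A x + \<bar>V x\<bar> ^ p)"
    proof (cases "x \<in> A")
      case True
      have "\<bar>V x\<bar> \<le> 1 + \<bar>V x\<bar> ^ p"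
      proof (cases "\<bar>V x\<bar> \<le> 1")
        case False
        then have "\<bar>V x\<bar> ^ 1 \<le> \<bar>V x\<bar> ^ p"
          using p by (intro power_increasing) auto
        then show ?thesis by simp
      qed (simp add: add_increasing2)
      then show ?thesis using True by simp
    next
      case False
      then show ?thesis using x by (simp add: g_def)
    qed
  qed
  ultimately have "integrable lborel V"
    by - (erule Bochner_Integration.integrable_bound, simp, assumption)
  moreover have "AE x in lborel. x \<in> A \<longrightarrow> V x = v x"
    using ae by eventually_elim (auto simp: g_def)
  ultimately show ?thesis
    using that Vp by auto
qed

section \<open>Transfer of the integral identity to Sobolev maps\<close>

lemma abs_det_le:
  fixes A :: "real ^ 'n::finite ^ 'n"
  shows "\<bar>det A\<bar> \<le> fact CARD('n) * (\<Sum>i\<in>UNIV. \<Sum>j\<in>UNIV. \<bar>A $ i $ j\<bar> ^ CARD('n))"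
proof -
  let ?S = "\<Sum>i\<in>UNIV. \<Sum>j\<in>UNIV. \<bar>A $ i $ j\<bar> ^ CARD('n)"
  let ?P = "{p. p permutes (UNIV :: 'n set)}"
  have prod: "(\<Prod>i\<in>UNIV. \<bar>A $ i $ p i\<bar>) \<le> ?S" for p
  proof -
    \<comment> \<open>Every factor of the product is at most the largest one, whose
      \<open>N\<close>-th power is itself one of the summands of \<open>?S\<close>.\<close>
    define m where "m = Max (range (\<lambda>i. \<bar>A $ i $ p i\<bar>))"
    have "m \<in> range (\<lambda>i. \<bar>A $ i $ p i\<bar>)"
      unfolding m_def by (intro Max_in) auto
    then obtain k where k: "m = \<bar>A $ k $ p k\<bar>"
      by auto
    have "(\<Prod>i\<in>UNIV. \<bar>A $ i $ p i\<bar>) \<le> (\<Prod>i\<in>(UNIV :: 'n set). m)"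
      by (intro prod_mono) (auto simp: m_def)
    also have "\<dots> = \<bar>A $ k $ p k\<bar> ^ CARD('n)"
      by (simp add: k)
    also have "\<dots> \<le> (\<Sum>j\<in>UNIV. \<bar>A $ k $ j\<bar> ^ CARD('n))"
      by (rule member_le_sum) auto
    also have "\<dots> \<le> ?S"
      by (rule member_le_sum[of k UNIV "\<lambda>i. \<Sum>j\<in>UNIV. \<bar>A $ i $ j\<bar> ^ CARD('n)"]) (auto intro: sum_nonneg)
    finally show ?thesis .
  qed
  have "\<bar>det A\<bar> \<le> (\<Sum>p\<in>?P. \<bar>of_int (sign p) * (\<Prod>i\<in>UNIV. A $ i $ p i)\<bar>)"
    unfolding det_def by (rule sum_abs)
  also have "\<dots> = (\<Sum>p\<in>?P. (\<Prod>i\<in>UNIV. \<bar>A $ i $ p i\<bar>))"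
    by (intro sum.cong) (auto simp: abs_mult sign_def abs_prod)
  also have "\<dots> \<le> (\<Sum>p\<in>?P. ?S)"
    by (intro sum_mono prod)
  also have "\<dots> = fact CARD('n) * ?S"
    by (simp add: card_permutations)
  finally show ?thesis .
qed

lemma weight_continuous: "continuous_on S (weight m \<rho> y)"
  unfolding weight_def[abs_def] Let_def by (intro continuous_intros)

lemma weight_bounded:
  obtains M where "M \<ge> 0" "\<And>z. \<bar>weight m \<rho> y (z :: real ^ 'n::finite)\<bar> \<le> M"
proof -
  have "compact (weight m \<rho> y ` cball y \<bar>\<rho>\<bar>)"
    by (intro compact_continuous_image weight_continuous) auto
  then obtain M where M: "\<And>z. z \<in> cball y \<bar>\<rho>\<bar> \<Longrightarrow> norm (weight m \<rho> y z) \<le> M"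
    using compact_imp_bounded bounded_iff by (metis imageI)
  have "\<bar>weight m \<rho> y z\<bar> \<le> max 0 M" for z
  proof (cases "z \<in> cball y \<bar>\<rho>\<bar>")
    case True
    then show ?thesis using M[of z] by auto
  next
    case False
    then have "\<rho>\<^sup>2 \<le> (dist z y)\<^sup>2"
      by (simp add: abs_le_square_iff[symmetric] dist_commute)
    then show ?thesis by (simp add: weight_def)
  qed
  then show ?thesis by (intro that[of "max 0 M"]) auto
qed

text \<open>Limit of \<open>integral_weight_det_smooth\<close> along mollifications. The slack
  \<open>\<delta>\<close> absorbs the uniform mollification error: off \<open>C\<close> the map is
  farther than \<open>\<rho> + \<delta>\<close> from \<open>y\<close>, hence the mollified map is
  still at distance at least \<open>\<rho>\<close>. The matrix \<open>V\<close> is a measurable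
  version of \<open>D\<close> on \<open>C\<close>.\<close>

lemma integral_weight_det_eq_0:
  fixes f :: "real ^ 'n::finite \<Rightarrow> real ^ 'n"
  assumes G: "open G" "continuous_on G f" and W1: "W1_loc CARD('n) G f D"
    and pos: "\<rho> > 0" "\<delta> > 0" and C: "compact C" "C = {x \<in> G. dist (f x) y \<le> \<rho> + \<delta>}"
  obtains V :: "real ^ 'n \<Rightarrow> real ^ 'n ^ 'n" where "AE x in lborel. x \<in> C \<longrightarrow> V x = D x"
    "integrable lborel (\<lambda>x. indicator C x * (weight m \<rho> y (f x) * det (V x)))"
    "(LINT x|lborel. indicator C x * (weight m \<rho> y (f x) * det (V x))) = 0"
proof -
  let ?N = "CARD('n)" and ?B = "moll_bound CARD('n)"
  have CG: "C \<subseteq> G"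
    using C by auto
  obtain \<epsilon> where \<epsilon>: "\<epsilon> > 0" "(\<Union>x\<in>C. ball x \<epsilon>) \<subseteq> G"
    using compact_subset_open_imp_ball_epsilon_subset[OF C(1) G(1) CG] by metis
  \<comment> \<open>Two neighbourhoods of \<open>C\<close>: on the open set \<open>W\<close> of
    width \<open>\<epsilon> / 4\<close> the mollified maps are used, and the compact set
    \<open>A\<close> of width \<open>\<epsilon> / 2\<close> contains every cube that mollification
    at points of \<open>W\<close> reads.\<close>
  define A where "A = {x + z |x z. x \<in> C \<and> z \<in> cball 0 (\<epsilon> / 2)}"
  define W where "W = (\<Union>x\<in>C. ball x (\<epsilon> / 4))"
  have A: "compact A"
    unfolding A_def by (intro compact_sums C) auto
  have A_I: "z \<in> A" if "x \<in> C" "dist x z \<le> \<epsilon> / 2" for x z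
    unfolding A_def using that by (intro CollectI exI[of _ x] exI[of _ "z - x"]) (auto simp: dist_norm norm_minus_commute)
  have AG: "A \<subseteq> G"
  proof
    fix a
    assume "a \<in> A"
    then obtain x z where "a = x + z" "x \<in> C" "norm z \<le> \<epsilon> / 2"
      by (auto simp: A_def)
    then have "a \<in> ball x \<epsilon>" "x \<in> C"
      using \<epsilon>(1) by (auto simp: dist_norm)
    then have "a \<in> (\<Union>x\<in>C. ball x \<epsilon>)"
      by blast
    then show "a \<in> G"
      using \<epsilon>(2) by blast
  qed
  have W: "open W" "C \<subseteq> W"
    using \<epsilon> by (auto simp: W_def)
  \<comment> \<open>A cube of side below \<open>h0\<close> has its points within
    \<open>\<epsilon> / 4\<close> of its lower corner, by \<open>cube_subset_cball\<close>.\<close>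
  define h0 where "h0 = \<epsilon> / (4 * real ?N)"
  have h0: "h0 > 0"
    using \<epsilon> by (simp add: h0_def)
  have QA: "cbox x (x + vec h) \<subseteq> A" if hx: "x \<in> W" "0 < h" "h < h0" for x h
  proof
    fix z
    assume "z \<in> cbox x (x + vec h)"
    then have "dist x z \<le> real ?N * h"
      using cube_subset_cball[of h x] hx by auto
    also have "\<dots> \<le> \<epsilon> / 4"
      using hx(3) by (simp add: h0_def field_simps)
    finally have "dist x z \<le> \<epsilon> / 4" .
    moreover obtain c where "c \<in> C" "dist c x < \<epsilon> / 4"
      using hx by (auto simp: W_def)
    ultimately show "z \<in> A"
      using dist_triangle[of c z x] by (intro A_I[of c]) auto
  qed
  have WA: "W \<subseteq> A"
    unfolding W_def using A_I \<epsilon>(1) by force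
  obtain U where U: "continuous_on UNIV U" and Uf: "\<And>x. x \<in> A \<Longrightarrow> U x = f x"
  proof (rule Dugundji[of UNIV UNIV A f])
    show "closedin (top_of_set UNIV) A"
      using compact_imp_closed[OF A] by simp
    show "continuous_on A f"
      using G(2) AG by (rule continuous_on_subset)
  qed auto
  have Ui: "continuous_on UNIV (\<lambda>x. U x $ i)" for i
    using U by (intro continuous_intros)
  define P where "P i j Vij \<longleftrightarrow> Vij \<in> borel_measurable borel \<and> integrable lborel Vij \<and>
      integrable lborel (\<lambda>x. \<bar>Vij x\<bar> ^ ?N) \<and> (AE x in lborel. x \<in> A \<longrightarrow> Vij x = D x $ i $ j)" for i j Vij
  have "\<exists>Vij. P i j Vij" for i j
  proof -
    have "L_loc ?N G (\<lambda>x. D x $ i $ j)"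
      using W1 by (simp add: W1_loc_def)
    moreover have "?N > 0"
      by simp
    ultimately obtain Vij where "Vij \<in> borel_measurable borel" "integrable lborel Vij"
      "integrable lborel (\<lambda>x. \<bar>Vij x\<bar> ^ ?N)" "AE x in lborel. x \<in> A \<longrightarrow> Vij x = D x $ i $ j"
      by (rule L_loc_borel_version[OF _ _ A AG])
    then show ?thesis unfolding P_def by blast
  qed
  then obtain v where "\<And>i j. P i j (v i j)"
    by metis
  then have v: "\<And>i j. v i j \<in> borel_measurable borel" "\<And>i j. integrable lborel (v i j)"
      "\<And>i j. integrable lborel (\<lambda>x. \<bar>v i j x\<bar> ^ ?N)" "\<And>i j. AE x in lborel. x \<in> A \<longrightarrow> v i j x = D x $ i $ j"
    unfolding P_def by blast+
  note [measurable] = v(1)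
  define V where "V x = (\<chi> i j. v i j x)" for x
  have VD: "AE x in lborel. x \<in> A \<longrightarrow> V x = D x"
  proof -
    have "AE x in lborel. \<forall>i j. x \<in> A \<longrightarrow> v i j x = D x $ i $ j"
      by (intro eventually_all_finite v(4))
    then show ?thesis
      by eventually_elim (auto simp: V_def vec_eq_iff)
  qed
  define g where "g h i = corr (\<lambda>x. U x $ i) (moll h)" for h i
  have unif: "\<exists>d>0. \<forall>h x. 0 < h \<longrightarrow> h < d \<longrightarrow> x \<in> W \<longrightarrow> dist (\<chi> i. g h i x) (U x) \<le> e" if "e > 0" for e
  proof -
    define e' where "e' = e / (real ?N * (?B + 1))"
    have B: "?B \<ge> 0"
      by (rule moll_bound_nonneg)
    have e': "e' > 0"
      unfolding e'_def using that B by (intro divide_pos_pos mult_pos_pos) auto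
    have "real ?N * (?B * e') \<le> real ?N * ((?B + 1) * e')"
      using e' by (intro mult_left_mono mult_right_mono) auto
    also have "\<dots> = e"
      using B by (simp add: e'_def)
    finally have Be: "real ?N * (?B * e') \<le> e" .
    have "uniformly_continuous_on A U"
      using A continuous_on_subset[OF U] by (intro compact_uniformly_continuous) auto
    then obtain d where d: "d > 0" "\<And>x z. x \<in> A \<Longrightarrow> z \<in> A \<Longrightarrow> dist z x < d \<Longrightarrow> dist (U z) (U x) < e'"
      using e' unfolding uniformly_continuous_on_def by metis
    have "dist (\<chi> i. g h i x) (U x) \<le> e" if h: "0 < h" "h < min h0 (d / real ?N)" and x: "x \<in> W" for h x
    proof -
      have "\<bar>g h i x - U x $ i\<bar> \<le> ?B * e'" for i
        unfolding g_def
      proof (rule corr_moll_close[OF Ui h(1)])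
        fix z
        assume z: "z \<in> cbox x (x + vec h)"
        then have "dist x z \<le> real ?N * h"
          using cube_subset_cball[of h x] h by auto
        also have "\<dots> < d"
          using h by (simp add: field_simps)
        finally have "dist (U z) (U x) < e'"
          using z QA[OF x h(1)] h x WA by (intro d(2)) (auto simp: dist_commute)
        then show "\<bar>U z $ i - U x $ i\<bar> \<le> e'"
          using component_le_norm_cart[of "U z - U x" i] by (simp add: dist_norm)
      qed
      then have "(\<Sum>i\<in>UNIV. \<bar>((\<chi> i. g h i x) - U x) $ i\<bar>) \<le> (\<Sum>i\<in>(UNIV :: 'n set). ?B * e')"
        by (intro sum_mono) simp
      with norm_le_l1_cart[of "(\<chi> i. g h i x) - U x"] Be show ?thesis
        by (simp add: dist_norm)
    qed
    moreover have "min h0 (d / real ?N) > 0"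
      using h0 d by simp
    ultimately show ?thesis by blast
  qed
  obtain d where d: "d > 0" "\<And>h x. 0 < h \<Longrightarrow> h < d \<Longrightarrow> x \<in> W \<Longrightarrow> dist (\<chi> i. g h i x) (U x) \<le> \<delta>"
    using unif[OF pos(2)] by metis
  \<comment> \<open>Starting with the factor \<open>1 / 2\<close> instead of \<open>1\<close> makes
    \<open>hs n\<close> strictly smaller than \<open>h0\<close> and \<open>d\<close> already for
    \<open>n = 0\<close>.\<close>
  define hs where "hs n = min h0 d * inverse (real (Suc (Suc n)))" for n :: nat
  have hs_pos: "0 < hs n" for n
    using h0 d by (simp add: hs_def)
  have hs_less: "hs n < h0" "hs n < d" for n
  proof -
    have "hs n < min h0 d"
      using h0 d(1) mult_strict_left_mono[of "inverse (real (Suc (Suc n)))" 1 "min h0 d"]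
      by (simp add: hs_def inverse_less_1_iff)
    then show "hs n < h0" "hs n < d" by auto
  qed
  have hs0: "hs \<longlonglongrightarrow> 0"
    unfolding hs_def
    by (intro tendsto_mult_right_zero LIMSEQ_Suc[OF LIMSEQ_inverse_real_of_nat])
  then have hs_lim: "filterlim hs (at_right 0) sequentially"
    using hs_pos by (intro tendsto_imp_filterlim_at_right) auto
  define gs where "gs n x = indicator C x * (weight m \<rho> y (\<chi> i. g (hs n) i x) * det (\<chi> i j. corr (v i j) (moll (hs n)) x))" for n x
  have pd: "partial_deriv j (g (hs n) i) x = corr (v i j) (moll (hs n)) x" if "x \<in> W" for i j n x
    unfolding g_def
  proof (rule partial_deriv_corr_moll[OF G(1) _ _ AG Ui _ v(1,4) hs_pos QA[OF that hs_pos hs_less(1)]])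
    show "weak_partial_deriv j G (\<lambda>x. f x $ i) (\<lambda>x. D x $ i $ j)"
      "(\<lambda>x. D x $ i $ j) \<in> borel_measurable (lebesgue_on G)"
      using W1 unfolding W1_loc_def L_loc_def by blast+
  qed (simp add: Uf)
  have gs0: "integral\<^sup>L lborel (gs n) = 0" for n
  proof -
    have "(LINT x|lborel. indicator C x * (weight m \<rho> y (\<chi> i. g (hs n) i x) * det (\<chi> i j. partial_deriv j (g (hs n) i) x))) = 0"
    proof (rule integral_weight_det_smooth[OF _ _ W(1) C(1) W(2) pos(1)])
      show "C_k (Suc (Suc 0)) (g (hs n) i)" for i
        unfolding g_def by (rule C_k_corr[OF Ui C_k_moll moll_eq_0_cball[OF hs_pos]])
      show "partial_deriv j (partial_deriv l (g (hs n) i)) x = partial_deriv l (partial_deriv j (g (hs n) i)) x" for i j l x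
        unfolding g_def
        by (rule partial_deriv_corr_commute[OF Ui C_k_moll moll_eq_0_cball[OF hs_pos] partial_deriv_moll_commute])
      fix x
      assume x: "x \<in> W - C"
      then have "dist (f x) y > \<rho> + \<delta>"
        using C(2) WA AG by auto
      moreover have "dist (\<chi> i. g (hs n) i x) (f x) \<le> \<delta>"
        using d(2)[OF hs_pos hs_less(2), of x n] x Uf[of x] WA by auto
      ultimately show "\<rho> \<le> dist (\<chi> i. g (hs n) i x) y"
        using dist_triangle[of "f x" y "\<chi> i. g (hs n) i x"] by (simp add: dist_commute)
    qed
    also have "(\<lambda>x. indicator C x * (weight m \<rho> y (\<chi> i. g (hs n) i x) * det (\<chi> i j. partial_deriv j (g (hs n) i) x))) = gs n"
    proof
      fix x
      show "indicator C x * (weight m \<rho> y (\<chi> i. g (hs n) i x) * det (\<chi> i j. partial_deriv j (g (hs n) i) x)) = gs n x"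
      proof (cases "x \<in> C")
        case True
        then have "x \<in> W" using W by auto
        then show ?thesis
          by (simp add: gs_def pd)
      qed (simp add: gs_def)
    qed
    finally show ?thesis .
  qed
  define G0 where "G0 x = indicator C x * (weight m \<rho> y (U x) * det (V x))" for x
  obtain M where M: "M \<ge> 0" "\<And>z :: real ^ 'n. \<bar>weight m \<rho> y z\<bar> \<le> M"
    using weight_bounded by metis
  define c where "c = M * fact ?N"
  have c: "c \<ge> 0"
    using M by (simp add: c_def)
  \<comment> \<open>The majorants: \<open>abs_det_le\<close> bounds the determinant by
    \<open>N\<close>-th powers of mollified entries, and Jensen's inequality bounds these by
    mollified \<open>N\<close>-th powers. Their integrals equal that of \<open>w0\<close> because
    mollification preserves mass.\<close>
  define w where "w n x = c * (\<Sum>i\<in>UNIV. \<Sum>j\<in>UNIV. corr (\<lambda>x. \<bar>v i j x\<bar> ^ ?N) (moll (hs n)) x)" for n x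
  define w0 where "w0 x = c * (\<Sum>i\<in>UNIV. \<Sum>j\<in>UNIV. \<bar>v i j x\<bar> ^ ?N)" for x
  have C_meas [measurable]: "C \<in> sets borel"
    using C(1) by (rule borel_compact)
  have weight_meas [measurable]: "weight m \<rho> y \<in> borel_measurable borel"
    by (intro borel_measurable_continuous_onI weight_continuous)
  have U_meas [measurable]: "U \<in> borel_measurable borel" "(\<lambda>x. U x $ i) \<in> borel_measurable borel" for i
    using U Ui by (auto intro: borel_measurable_continuous_onI)
  have vec_meas: "(\<lambda>x. \<chi> i. q i x) \<in> borel_measurable borel" if [measurable]: "\<And>i. q i \<in> borel_measurable borel"
    for q :: "'n \<Rightarrow> real ^ 'n \<Rightarrow> real"
  proof -
    have "(\<chi> i. q i x) = (\<Sum>i\<in>UNIV. q i x *\<^sub>R axis i 1)" for x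
      using basis_expansion[of "\<chi> i. q i x"] by (simp add: scalar_mult_eq_scaleR)
    then show ?thesis by simp
  qed
  have corr_nonneg: "0 \<le> corr (\<lambda>x. \<bar>v i j x\<bar> ^ ?N) (moll (hs n)) x" for i j n x
    unfolding corr_def by (intro integral_nonneg_AE AE_I2 mult_nonneg_nonneg moll_nonneg hs_pos) auto
  have lim: "integrable lborel G0 \<and> (\<lambda>n. integral\<^sup>L lborel (gs n)) \<longlonglongrightarrow> integral\<^sup>L lborel G0"
  proof (rule integral_tendsto_dominated_sequence[of gs lborel G0 w w0])
    have det_meas: "(\<lambda>x. det (\<chi> i j. q i j x)) \<in> borel_measurable borel" if [measurable]: "\<And>i j. q i j \<in> borel_measurable borel"
      for q :: "'n \<Rightarrow> 'n \<Rightarrow> real ^ 'n \<Rightarrow> real"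
      unfolding det_def by simp
    show "gs n \<in> borel_measurable lborel" for n
    proof -
      have "(\<lambda>x. weight m \<rho> y (\<chi> i. g (hs n) i x)) \<in> borel_measurable borel"
        unfolding g_def
        by (rule measurable_compose[OF vec_meas weight_meas]) measurable
      moreover have "(\<lambda>x. det (\<chi> i j. corr (v i j) (moll (hs n)) x)) \<in> borel_measurable borel"
        by (rule det_meas) measurable
      ultimately show ?thesis
        unfolding gs_def by measurable
    qed
    show "G0 \<in> borel_measurable lborel"
    proof -
      have "(\<lambda>x. det (V x)) \<in> borel_measurable borel"
        unfolding V_def by (rule det_meas) measurable
      then show ?thesis
        unfolding G0_def by measurable
    qed
    show "w n \<in> borel_measurable lborel" for n
      unfolding w_def by measurable
    show "integrable lborel w0"
      unfolding w0_def by (intro integrable_mult_right Bochner_Integration.integrable_sum v)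
    have "AE x in lborel. \<forall>i j. ((\<lambda>h. corr (v i j) (moll h) x) \<longlongrightarrow> v i j x) (at_right 0)"
      by (intro eventually_all_finite corr_moll_tendsto_AE v)
    then show "AE x in lborel. (\<lambda>n. gs n x) \<longlonglongrightarrow> G0 x"
    proof eventually_elim
      fix x
      assume x: "\<forall>i j. ((\<lambda>h. corr (v i j) (moll h) x) \<longlongrightarrow> v i j x) (at_right 0)"
      then have v_lim: "(\<lambda>n. corr (v i j) (moll (hs n)) x) \<longlonglongrightarrow> v i j x" for i j
        using filterlim_compose[OF _ hs_lim] by blast
      have det_lim: "(\<lambda>n. det (\<chi> i j. corr (v i j) (moll (hs n)) x)) \<longlonglongrightarrow> det (V x)"
        unfolding det_def V_def vec_lambda_beta by (intro tendsto_intros v_lim)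
      show "(\<lambda>n. gs n x) \<longlonglongrightarrow> G0 x"
      proof (cases "x \<in> C")
        case True
        then have "x \<in> W" using W by auto
        have "(\<lambda>n. \<chi> i. g (hs n) i x) \<longlonglongrightarrow> U x"
        proof (rule LIMSEQ_I)
          fix r :: real
          assume "r > 0"
          then obtain d' where d': "d' > 0" "\<And>h. 0 < h \<Longrightarrow> h < d' \<Longrightarrow> dist (\<chi> i. g h i x) (U x) \<le> r / 2"
            using unif[of "r / 2"] \<open>x \<in> W\<close> by auto
          have "\<forall>\<^sub>F n in sequentially. hs n < d'"
            using hs0 d'(1) by (rule order_tendstoD)
          then obtain n0 where "\<And>n. n \<ge> n0 \<Longrightarrow> hs n < d'"
            by (auto simp: eventually_sequentially)
          then have "norm ((\<chi> i. g (hs n) i x) - U x) < r" if "n \<ge> n0" for n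
            using d'(2)[OF hs_pos, of n] that \<open>r > 0\<close> by (fastforce simp: dist_norm)
          then show "\<exists>n0. \<forall>n\<ge>n0. norm ((\<chi> i. g (hs n) i x) - U x) < r"
            by blast
        qed
        moreover have "isCont (weight m \<rho> y) (U x)"
          using weight_continuous[of UNIV m \<rho> y] by (simp add: continuous_on_eq_continuous_at)
        ultimately have "(\<lambda>n. weight m \<rho> y (\<chi> i. g (hs n) i x)) \<longlonglongrightarrow> weight m \<rho> y (U x)"
          by (rule isCont_tendsto_compose[rotated])
        with det_lim show ?thesis
          unfolding gs_def G0_def by (intro tendsto_intros)
      qed (simp add: gs_def G0_def)
    qed
    have "AE x in lborel. \<forall>i j. ((\<lambda>h. corr (\<lambda>x. \<bar>v i j x\<bar> ^ ?N) (moll h) x) \<longlongrightarrow> \<bar>v i j x\<bar> ^ ?N) (at_right 0)"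
      by (intro eventually_all_finite corr_moll_tendsto_AE v)
    then show "AE x in lborel. (\<lambda>n. w n x) \<longlonglongrightarrow> w0 x"
    proof eventually_elim
      fix x
      assume x: "\<forall>i j. ((\<lambda>h. corr (\<lambda>x. \<bar>v i j x\<bar> ^ ?N) (moll h) x) \<longlongrightarrow> \<bar>v i j x\<bar> ^ ?N) (at_right 0)"
      then have "(\<lambda>n. corr (\<lambda>x. \<bar>v i j x\<bar> ^ ?N) (moll (hs n)) x) \<longlonglongrightarrow> \<bar>v i j x\<bar> ^ ?N" for i j
        using filterlim_compose[OF _ hs_lim] by blast
      then show "(\<lambda>n. w n x) \<longlonglongrightarrow> w0 x"
        unfolding w_def w0_def by (intro tendsto_mult tendsto_const tendsto_sum)
    qed
    show "\<bar>gs n x\<bar> \<le> w n x" for n x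
    proof (cases "x \<in> C")
      case True
      have "\<bar>gs n x\<bar> = \<bar>weight m \<rho> y (\<chi> i. g (hs n) i x)\<bar> * \<bar>det (\<chi> i j. corr (v i j) (moll (hs n)) x)\<bar>"
        using True by (simp add: gs_def abs_mult)
      also have "\<dots> \<le> M * (fact ?N * (\<Sum>i\<in>UNIV. \<Sum>j\<in>UNIV. \<bar>corr (v i j) (moll (hs n)) x\<bar> ^ ?N))"
        using M abs_det_le[of "\<chi> i j. corr (v i j) (moll (hs n)) x"] by (intro mult_mono) auto
      also have "\<dots> \<le> w n x"
        unfolding w_def c_def mult.assoc
        by (intro mult_left_mono sum_mono corr_moll_power_le hs_pos v M) auto
      finally show ?thesis .
    next
      case False
      then show ?thesis
        using c corr_nonneg by (auto simp: gs_def w_def intro!: mult_nonneg_nonneg sum_nonneg)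
    qed
    show "(\<integral>\<^sup>+x. ennreal (w n x) \<partial>lborel) \<le> (\<integral>\<^sup>+x. ennreal (w0 x) \<partial>lborel)" for n
    proof -
      have "(\<integral>\<^sup>+x. ennreal (w n x) \<partial>lborel)
          = (\<integral>\<^sup>+x. ennreal c * (\<Sum>i\<in>UNIV. \<Sum>j\<in>UNIV. ennreal (corr (\<lambda>x. \<bar>v i j x\<bar> ^ ?N) (moll (hs n)) x)) \<partial>lborel)"
        unfolding w_def using c corr_nonneg by (simp add: ennreal_mult sum_nonneg)
      also have "\<dots> = ennreal c * (\<Sum>i\<in>UNIV. \<Sum>j\<in>UNIV. (\<integral>\<^sup>+x. ennreal (corr (\<lambda>x. \<bar>v i j x\<bar> ^ ?N) (moll (hs n)) x) \<partial>lborel))"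
        by (simp add: nn_integral_cmult nn_integral_sum del: sum_ennreal)
      also have "\<dots> = ennreal c * (\<Sum>i\<in>UNIV. \<Sum>j\<in>UNIV. (\<integral>\<^sup>+x. ennreal (\<bar>v i j x\<bar> ^ ?N) \<partial>lborel))"
        by (simp add: nn_integral_corr_moll[OF hs_pos v(3)])
      also have "\<dots> = (\<integral>\<^sup>+x. ennreal c * (\<Sum>i\<in>UNIV. \<Sum>j\<in>UNIV. ennreal (\<bar>v i j x\<bar> ^ ?N)) \<partial>lborel)"
        by (simp add: nn_integral_cmult nn_integral_sum del: sum_ennreal)
      also have "\<dots> = (\<integral>\<^sup>+x. ennreal (w0 x) \<partial>lborel)"
        unfolding w0_def using c by (simp add: ennreal_mult sum_nonneg)
      finally show ?thesis by simp
    qed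
  qed
  have "(\<lambda>n. integral\<^sup>L lborel (gs n)) \<longlonglongrightarrow> 0"
    unfolding gs0 by simp
  with lim have "integral\<^sup>L lborel G0 = 0"
    using LIMSEQ_unique by blast
  moreover have "(\<lambda>x. indicator C x * (weight m \<rho> y (f x) * det (V x))) = G0"
    unfolding G0_def using Uf W(2) WA by (auto simp: indicator_def fun_eq_iff)
  moreover have "AE x in lborel. x \<in> C \<longrightarrow> V x = D x"
    using VD by eventually_elim (use W(2) WA in auto)
  ultimately show ?thesis
    using lim by (intro that[of V]) auto
qed

section \<open>Quasiregular maps that omit a value\<close>

text \<open>Convergence at every point, unlike the almost-everywhere version; pointwise equalities
  of continuous maps are to be deduced from it.\<close>

lemma corr_moll_tendsto:
  fixes U :: "real ^ 'n::finite \<Rightarrow> real"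
  assumes U: "continuous_on UNIV U"
  shows "((\<lambda>h. corr U (moll h) x) \<longlongrightarrow> U x) (at_right 0)"
proof (rule tendstoI)
  fix e :: real
  assume "e > 0"
  let ?B = "moll_bound CARD('n)"
  have B: "?B \<ge> 0"
    by (rule moll_bound_nonneg)
  define e' where "e' = e / (?B + 1)"
  have e': "e' > 0"
    unfolding e'_def using \<open>e > 0\<close> B by (intro divide_pos_pos) auto
  have "(?B + 1) * e' = e"
    using B by (simp add: e'_def)
  with e' have Be: "?B * e' < e"
    by (simp add: algebra_simps)
  obtain d where d: "d > 0" "\<And>y. dist y x < d \<Longrightarrow> dist (U y) (U x) < e'"
    using U e' unfolding continuous_on_iff by (metis UNIV_I)
  have "dist (corr U (moll h) x) (U x) < e" if h: "0 < h" "h < d / real CARD('n)" for h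
  proof -
    have "\<bar>corr U (moll h) x - U x\<bar> \<le> ?B * e'"
    proof (rule corr_moll_close[OF U h(1)])
      fix y
      assume "y \<in> cbox x (x + vec h)"
      then have "dist x y \<le> real CARD('n) * h"
        using cube_subset_cball[of h x] h by auto
      also have "\<dots> < d"
        using h by (simp add: field_simps)
      finally show "\<bar>U y - U x\<bar> \<le> e'"
        using d(2)[of y] by (simp add: dist_commute dist_real_def)
    qed
    with Be show ?thesis by (simp add: dist_real_def)
  qed
  moreover have "d / real CARD('n) > 0"
    using d(1) by simp
  ultimately show "\<forall>\<^sub>F h in at_right 0. dist (corr U (moll h) x) (U x) < e"
    unfolding eventually_at_right_field by blast
qed

text \<open>The mollifications have zero gradient on \<open>ball x0 r\<close> and are constant
  there; letting \<open>h\<close> tend to \<open>0\<close> carries this over to \<open>u\<close>.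
  The doubled radius leaves room for the cubes, whose points stay within \<open>r\<close> of their
  corner.\<close>

lemma weak_derivative_0_imp_locally_constant:
  fixes u :: "real ^ 'n::finite \<Rightarrow> real"
  assumes G: "open G" "continuous_on G u"
    and weak: "\<And>j. weak_partial_deriv j G u (v j)" "\<And>j. v j \<in> borel_measurable (lebesgue_on G)"
    and B: "cball x0 (2 * r) \<subseteq> G" and r: "r > 0"
    and v0: "\<And>j. AE x in lborel. x \<in> cball x0 (2 * r) \<longrightarrow> v j x = 0"
    and x: "x \<in> ball x0 r"
  shows "u x = u x0"
proof -
  let ?A = "cball x0 (2 * r)"
  obtain U where U: "continuous_on UNIV U" and Uu: "\<And>x. x \<in> ?A \<Longrightarrow> U x = u x"
    by (rule Dugundji[of UNIV UNIV ?A u]) (use G(2) B continuous_on_subset in auto)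
  have const: "corr U (moll h) x = corr U (moll h) x0" if h: "0 < h" "h < r / real CARD('n)" for h
  proof -
    have D: "(corr U (moll h) has_derivative (\<lambda>v. 0)) (at z)" if z: "z \<in> ball x0 r" for z
    proof -
      have Q: "cbox z (z + vec h) \<subseteq> ?A"
      proof
        fix y
        assume "y \<in> cbox z (z + vec h)"
        then have "dist z y \<le> real CARD('n) * h"
          using cube_subset_cball[of h z] h by auto
        also have "\<dots> < r"
          using h by (simp add: field_simps)
        finally show "y \<in> ?A"
          using z dist_triangle[of x0 y z] by auto
      qed
      have "partial_deriv j (corr U (moll h)) z = corr (\<lambda>x. 0) (moll h) z" for j
        by (rule partial_deriv_corr_moll[OF G(1) weak(1,2) B U Uu _ _ h(1) Q]) (use v0[of j] in \<open>auto elim: eventually_mono\<close>)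
      then have "grad (corr U (moll h)) z = 0"
        by (simp add: vec_eq_iff corr_def)
      moreover have "corr U (moll h) differentiable at z"
        by (rule C_k_differentiable[OF C_k_corr[OF U C_k_moll moll_eq_0_cball[OF h(1)]]])
      ultimately show ?thesis
        using has_derivative_grad[of "corr U (moll h)" z] by simp
    qed
    obtain c where "\<And>z. z \<in> ball x0 r \<Longrightarrow> corr U (moll h) z = c"
      using has_derivative_zero_constant[of "ball x0 r" "corr U (moll h)"] D has_derivative_at_withinI
      by (metis convex_ball)
    then show ?thesis
      using x r by simp
  qed
  have "((\<lambda>h. corr U (moll h) x) \<longlongrightarrow> U x0) (at_right 0)"
  proof (rule Lim_transform_eventually[OF corr_moll_tendsto[OF U]])
    have "r / real CARD('n) > 0"
      using r by simp
    then show "\<forall>\<^sub>F h in at_right 0. corr U (moll h) x0 = corr U (moll h) x"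
      unfolding eventually_at_right_field using const by metis
  qed
  with corr_moll_tendsto[OF U, of x] have "U x = U x0"
    by (rule tendsto_unique[rotated]) simp
  moreover have "x \<in> ?A" "x0 \<in> ?A"
    using x r by auto
  ultimately show ?thesis
    using Uu by metis
qed

text \<open>If some value is closer than \<open>\<rho>\<close> to the omitted \<open>y\<close>, the
  derivative vanishes almost everywhere on the region of such values, and the fibre of that value is
  open and closed in \<open>G\<close>. The gap between \<open>\<rho>\<close> and
  \<open>\<rho>'\<close> is spent as the slack \<open>\<delta>\<close> of the integral
  identity.\<close>

lemma quasiregular_on_cases:
  fixes f :: "real ^ 'n::finite \<Rightarrow> real ^ 'n"
  assumes qr: "quasiregular_on G f" and conn: "connected G"
    and y: "y \<notin> f ` G" and \<rho>: "0 < \<rho>" "\<rho> < \<rho>'" and comp: "compact {x \<in> G. dist (f x) y \<le> \<rho>'}"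
  shows "(\<exists>c. \<forall>x\<in>G. f x = c) \<or> (\<forall>x\<in>G. \<rho> \<le> dist (f x) y)"
proof (rule disjCI, rule ccontr)
  assume "\<not> (\<forall>x\<in>G. \<rho> \<le> dist (f x) y)" and nconst: "\<nexists>c. \<forall>x\<in>G. f x = c"
  then obtain x1 where x1: "x1 \<in> G" "dist (f x1) y < \<rho>"
    by force
  have G: "open G" "continuous_on G f"
    using qr by (auto simp: quasiregular_on_def)
  obtain D K where D: "W1_loc CARD('n) G f D" and K: "K \<ge> 1"
    and ae: "AE x in lebesgue_on G. onorm ((*v) (D x)) ^ CARD('n) \<le> K * det (D x)"
    using qr by (auto simp: quasiregular_on_def)
  have "AE x in lebesgue. x \<in> G \<longrightarrow> onorm ((*v) (D x)) ^ CARD('n) \<le> K * det (D x)"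
    using ae by (subst (asm) AE_restrict_space_iff) (use G in auto)
  then have ae': "AE x in lborel. x \<in> G \<longrightarrow> onorm ((*v) (D x)) ^ CARD('n) \<le> K * det (D x)"
    by (simp only: AE_completion_iff)
  define C where "C = {x \<in> G. dist (f x) y \<le> \<rho>'}"
  have C: "compact C"
    using comp by (simp add: C_def)
  have x1C: "x1 \<in> C"
    using x1 \<rho> by (simp add: C_def)
  have Cf: "continuous_on C f"
    by (rule continuous_on_subset[OF G(2)]) (auto simp: C_def)
  \<comment> \<open>The value \<open>y\<close> is omitted and \<open>C\<close> is compact, so the
    distance to \<open>y\<close> attains a positive minimum on \<open>C\<close>.\<close>
  obtain \<epsilon> where \<epsilon>: "\<epsilon> > 0" "\<And>x. x \<in> C \<Longrightarrow> \<epsilon> \<le> dist (f x) y"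
  proof -
    have "continuous_on C (\<lambda>x. dist (f x) y)"
      by (intro continuous_intros Cf)
    then obtain x2 where x2: "x2 \<in> C" "\<And>x. x \<in> C \<Longrightarrow> dist (f x2) y \<le> dist (f x) y"
      using continuous_attains_inf[OF C] x1C by blast
    moreover have "dist (f x2) y > 0"
      using x2(1) y by (auto simp: C_def)
    ultimately show ?thesis using that by blast
  qed
  \<comment> \<open>With \<open>s\<close> between \<open>\<epsilon>^2\<close> and
    \<open>\<rho>^2\<close>, this \<open>m\<close> gives \<open>N (\<rho>^2 - s) \<le> N \<rho>^2 <
    m \<epsilon>^2 \<le> 2 (m + 2) s\<close>, so the second factor of \<open>weight\<close> is
    negative.\<close>
  obtain m :: nat where m: "real CARD('n) * \<rho>\<^sup>2 / \<epsilon>\<^sup>2 < real m"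
    using reals_Archimedean2 by blast
  have weight_neg: "weight m \<rho> y (f x) < 0" if "x \<in> C" "dist (f x) y < \<rho>" for x
  proof -
    let ?s = "(dist (f x) y)\<^sup>2"
    have s: "\<epsilon>\<^sup>2 \<le> ?s" "?s < \<rho>\<^sup>2"
      using \<epsilon> that by (auto intro!: power_mono power_strict_mono simp: less_imp_le)
    have "real CARD('n) * (\<rho>\<^sup>2 - ?s) \<le> real CARD('n) * \<rho>\<^sup>2"
      by (intro mult_left_mono) auto
    also have "\<dots> < real m * \<epsilon>\<^sup>2"
      using m \<epsilon>(1) by (simp add: field_simps)
    also have "\<dots> \<le> 2 * real (m + 2) * ?s"
      using s(1) by (intro mult_mono) auto
    finally show ?thesis
      using s(2) by (auto simp: weight_def Let_def intro!: mult_pos_neg)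
  qed
  have weight_nonpos: "weight m \<rho> y (f x) \<le> 0" if "x \<in> C" for x
  proof (cases "dist (f x) y < \<rho>")
    case True
    then show ?thesis using weight_neg[OF that] by simp
  next
    case False
    then have "\<rho>\<^sup>2 \<le> (dist (f x) y)\<^sup>2"
      using \<rho> by (intro power_mono) auto
    then show ?thesis by (simp add: weight_def)
  qed
  obtain V :: "real ^ 'n \<Rightarrow> real ^ 'n ^ 'n" where V: "AE x in lborel. x \<in> C \<longrightarrow> V x = D x"
    "integrable lborel (\<lambda>x. indicator C x * (weight m \<rho> y (f x) * det (V x)))"
    "(LINT x|lborel. indicator C x * (weight m \<rho> y (f x) * det (V x))) = 0"
    by (rule integral_weight_det_eq_0[OF G D \<rho>(1) _ C, of "\<rho>' - \<rho>" y m]) (use \<rho> in \<open>auto simp: C_def\<close>)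
  let ?F = "\<lambda>x. - (indicator C x * (weight m \<rho> y (f x) * det (V x)))"
  have "AE x in lborel. 0 \<le> ?F x"
    using V(1) ae'
  proof eventually_elim
    fix x
    assume 1: "x \<in> C \<longrightarrow> V x = D x" and 2: "x \<in> G \<longrightarrow> onorm ((*v) (D x)) ^ CARD('n) \<le> K * det (D x)"
    show "0 \<le> ?F x"
    proof (cases "x \<in> C")
      case True
      then have "0 \<le> K * det (D x)"
        using 2 onorm_pos_le[OF matrix_vector_mul_bounded_linear[of "D x"]]
        by (auto simp: C_def intro: order_trans zero_le_power)
      then have "0 \<le> det (D x)"
        using K by (simp add: zero_le_mult_iff)
      then show ?thesis
        using True 1 weight_nonpos[OF True] by (simp add: mult_nonpos_nonneg)
    qed simp
  qed
  then have "AE x in lborel. ?F x = 0"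
    using integral_nonneg_eq_0_iff_AE[of lborel ?F] V(2,3) by auto
  then have D0: "AE x in lborel. x \<in> G \<and> dist (f x) y < \<rho> \<longrightarrow> D x = 0"
    using V(1) ae'
  proof eventually_elim
    fix x
    assume 0: "?F x = 0" and 1: "x \<in> C \<longrightarrow> V x = D x"
      and 2: "x \<in> G \<longrightarrow> onorm ((*v) (D x)) ^ CARD('n) \<le> K * det (D x)"
    show "x \<in> G \<and> dist (f x) y < \<rho> \<longrightarrow> D x = 0"
    proof
      assume x: "x \<in> G \<and> dist (f x) y < \<rho>"
      then have "x \<in> C"
        using \<rho> by (auto simp: C_def)
      then have "det (D x) = 0"
        using 0 1 weight_neg[of x] x by auto
      then have "onorm ((*v) (D x)) ^ CARD('n) \<le> 0"
        using 2 x by simp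
      moreover have "0 \<le> onorm ((*v) (D x))"
        by (rule onorm_pos_le[OF matrix_vector_mul_bounded_linear])
      ultimately have "onorm ((*v) (D x)) = 0"
        by (metis zero_le_power order_antisym power_eq_0_iff)
      then have "\<forall>z. D x *v z = 0"
        using onorm_eq_0[OF matrix_vector_mul_bounded_linear[of "D x"]] by simp
      then show "D x = 0"
        by (simp add: matrix_eq)
    qed
  qed
  \<comment> \<open>Every point of this fibre is mapped into \<open>ball y \<rho>\<close>, so a
    whole neighbourhood of it lies where \<open>D\<close> vanishes almost everywhere; hence the
    fibre is open.\<close>
  define S where "S = {x \<in> G. f x = f x1}"
  have "open S"
    unfolding open_contains_ball
  proof
    fix x0
    assume x0: "x0 \<in> S"
    have "open {x \<in> G. f x \<in> ball y \<rho>}"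
    proof -
      have "{x \<in> G. f x \<in> ball y \<rho>} = G \<inter> f -` ball y \<rho>"
        by auto
      then show ?thesis
        using continuous_open_preimage[OF G(2,1) open_ball] by simp
    qed
    moreover have "x0 \<in> {x \<in> G. f x \<in> ball y \<rho>}"
      using x0 x1 by (auto simp: S_def dist_commute)
    ultimately obtain e where e: "e > 0" "cball x0 e \<subseteq> {x \<in> G. f x \<in> ball y \<rho>}"
      unfolding open_contains_cball by blast
    define r where "r = e / 2"
    have r: "r > 0" "cball x0 (2 * r) \<subseteq> {x \<in> G. f x \<in> ball y \<rho>}"
      using e by (auto simp: r_def)
    have "f x $ i = f x0 $ i" if "x \<in> ball x0 r" for x i
    proof (rule weak_derivative_0_imp_locally_constant[OF G(1) _ _ _ _ r(1) _ that])
      show "continuous_on G (\<lambda>x. f x $ i)"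
        by (intro continuous_intros G)
      show "weak_partial_deriv j G (\<lambda>x. f x $ i) (\<lambda>x. D x $ i $ j)"
        "(\<lambda>x. D x $ i $ j) \<in> borel_measurable (lebesgue_on G)" for j
        using D unfolding W1_loc_def L_loc_def by blast+
      show "cball x0 (2 * r) \<subseteq> G"
        using r by auto
      show "AE x in lborel. x \<in> cball x0 (2 * r) \<longrightarrow> D x $ i $ j = 0" for j
        using D0
      proof eventually_elim
        fix x
        assume 0: "x \<in> G \<and> dist (f x) y < \<rho> \<longrightarrow> D x = 0"
        show "x \<in> cball x0 (2 * r) \<longrightarrow> D x $ i $ j = 0"
        proof
          assume "x \<in> cball x0 (2 * r)"
          then have "x \<in> G \<and> dist (f x) y < \<rho>"
            using subsetD[OF r(2), of x] by (simp add: dist_commute)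
          with 0 show "D x $ i $ j = 0" by simp
        qed
      qed
    qed
    then have f_eq: "f x = f x0" if "x \<in> ball x0 r" for x
      using that by (simp add: vec_eq_iff)
    have "ball x0 r \<subseteq> S"
    proof
      fix x
      assume x: "x \<in> ball x0 r"
      then have "x \<in> cball x0 (2 * r)"
        using r(1) by auto
      then have "x \<in> G"
        using r(2) by blast
      with f_eq[OF x] x0 show "x \<in> S"
        by (simp add: S_def)
    qed
    with r(1) show "\<exists>e>0. ball x0 e \<subseteq> S" by blast
  qed
  then have "openin (top_of_set G) S"
    by (intro open_subset) (auto simp: S_def)
  moreover have "closedin (top_of_set G) S"
    unfolding S_def by (rule continuous_closedin_preimage_constant[OF G(2)])
  ultimately have "S = {} \<or> S = G"
    using conn unfolding connected_clopen by blast
  with x1 have "S = G"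
    by (auto simp: S_def)
  with nconst show False
    by (auto simp: S_def)
qed

text \<open>A test function on \<open>H\<close> is one on \<open>G\<close>, and it vanishes with its
  derivatives off \<open>H\<close>; so the integrals over \<open>H\<close> and over \<open>G\<close>
  coincide.\<close>

lemma quasiregular_on_subset:
  fixes f :: "real ^ 'n::finite \<Rightarrow> real ^ 'n"
  assumes qr: "quasiregular_on G f" and H: "open H" "H \<subseteq> G"
  shows "quasiregular_on H f"
proof -
  have G: "open G" "continuous_on G f"
    using qr by (auto simp: quasiregular_on_def)
  obtain D K where D: "W1_loc CARD('n) G f D" and K: "K \<ge> 1"
    and ae: "AE x in lebesgue_on G. onorm ((*v) (D x)) ^ CARD('n) \<le> K * det (D x)"
    using qr by (auto simp: quasiregular_on_def)
  have L: "L_loc p H u" if "L_loc p G u" for p and u :: "real ^ 'n \<Rightarrow> real"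
    using that H measurable_restrict_mono[of u lebesgue G borel H] unfolding L_loc_def by blast
  have weak: "weak_partial_deriv j H u w" if uw: "weak_partial_deriv j G u w" for j u w
    unfolding weak_partial_deriv_def
  proof (intro allI impI)
    fix \<phi>
    assume \<phi>: "test_function H \<phi>"
    have \<phi>0: "\<phi> x = 0" if "x \<notin> H" for x
      using \<phi> that closure_subset[of "{x. \<phi> x \<noteq> 0}"] unfolding test_function_def by blast
    have p\<phi>0: "partial_deriv j \<phi> x = 0" if "x \<notin> H" for x
    proof (rule partial_deriv_eq_0_open[of "- closure {x. \<phi> x \<noteq> 0}"])
      show "x \<in> - closure {x. \<phi> x \<noteq> 0}"
        using \<phi> that unfolding test_function_def by blast
      show "\<phi> z = 0" if "z \<in> - closure {x. \<phi> x \<noteq> 0}" for z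
        using that closure_subset[of "{x. \<phi> x \<noteq> 0}"] by blast
    qed auto
    have eq: "(LINT x|lebesgue_on H. q x) = (LINT x|lebesgue_on G. q x)" if "\<And>x. x \<notin> H \<Longrightarrow> q x = 0"
      for q :: "real ^ 'n \<Rightarrow> real"
    proof -
      have "(\<lambda>x. indicator H x *\<^sub>R q x) = (\<lambda>x. indicator G x *\<^sub>R q x)"
        using that H by (force simp: indicator_def)
      then show ?thesis
        using H G by (simp add: integral_restrict_space)
    qed
    have "test_function G \<phi>"
      using \<phi> H unfolding test_function_def by blast
    then show "(LINT x|lebesgue_on H. u x * partial_deriv j \<phi> x) = - (LINT x|lebesgue_on H. w x * \<phi> x)"
      using uw \<phi>0 p\<phi>0 by (subst (1 2) eq) (auto simp: weak_partial_deriv_def)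
  qed
  have "AE x in lebesgue. x \<in> G \<longrightarrow> onorm ((*v) (D x)) ^ CARD('n) \<le> K * det (D x)"
    using ae by (subst (asm) AE_restrict_space_iff) (use G in auto)
  then have "AE x in lebesgue. x \<in> H \<longrightarrow> onorm ((*v) (D x)) ^ CARD('n) \<le> K * det (D x)"
    by eventually_elim (use H in auto)
  then have "AE x in lebesgue_on H. onorm ((*v) (D x)) ^ CARD('n) \<le> K * det (D x)"
    by (subst AE_restrict_space_iff) (use H in auto)
  moreover have "W1_loc CARD('n) H f D"
    using D L weak unfolding W1_loc_def by blast
  ultimately show ?thesis
    unfolding quasiregular_on_def using H K continuous_on_subset[OF G(2) H(2)] by blast
qed

section \<open>Poles and escaping orbits\<close>

lemma closed_preimage_Some:
  fixes f :: "'a::topological_space \<Rightarrow> 'b::t2_space option"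
  assumes "continuous_map euclidean (Alexandroff_compactification euclidean) f" "compact K"
  shows "closed {x. f x \<in> Some ` K}"
proof -
  have "closedin (Alexandroff_compactification euclidean) (Some ` K)"
    using assms(2) by (simp add: compact_imp_closed)
  from closedin_continuous_map_preimage[OF assms(1) this] show ?thesis
    by simp
qed

text \<open>Clopen argument on the exterior \<open>E\<close> of a ball containing the image of the
  sphere around \<open>a\<close>. The assumption on the dimension makes both \<open>E\<close> and
  the punctured ball \<open>G\<close> connected.\<close>

lemma pole_neighbourhood_covers:
  fixes f :: "real ^ 'n::finite \<Rightarrow> (real ^ 'n) option"
  assumes N: "CARD('n) \<ge> 2" and f: "quasimeromorphic f" and a: "a \<in> poles f" and "r > 0"
  obtains R where "\<And>y. norm y > R \<Longrightarrow> \<exists>x\<in>ball a r. f x = Some y"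
proof -
  have cont: "continuous_map euclidean (Alexandroff_compactification euclidean) f"
    and discrete: "\<And>x. \<not> x islimpt poles f"
    and qr: "quasiregular_on (- poles f) (\<lambda>x. the (f x))"
    using f by (auto simp: quasimeromorphic_def)
  define F where "F x = the (f x)" for x
  obtain e where e: "e > 0" "\<And>x. x \<in> poles f \<Longrightarrow> x \<noteq> a \<Longrightarrow> e \<le> dist x a"
    using discrete[of a] by (force simp: islimpt_approachable not_less)
  define s where "s = min r e / 2"
  have s: "s > 0" "s < r" "s < e"
    using e(1) \<open>r > 0\<close> by (auto simp: s_def)
  define G where "G = ball a s - {a}"
  have some: "f x = Some (F x)" if "x \<in> cball a s" "x \<noteq> a" for x
  proof -
    have "x \<notin> poles f"
      using e(2)[of x] that s by (auto simp: dist_commute)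
    then show ?thesis
      by (auto simp: poles_def F_def)
  qed
  have fa: "f a = None"
    using a by (simp add: poles_def)
  have G: "open G" "G \<subseteq> - poles f"
    using some by (force simp: G_def poles_def)+
  have conn: "connected G"
    unfolding G_def by (rule connected_punctured_ball) (use N in simp)
  have qrG: "quasiregular_on G F"
    using quasiregular_on_subset[OF qr G] by (simp add: F_def[abs_def])
  have a_lim: "a islimpt G"
    using interior_limit_point[of a "ball a s"] islimpt_punctured[of a "ball a s"] s(1) by (simp add: G_def)
  \<comment> \<open>If \<open>F\<close> were bounded on \<open>G\<close>, the pole would be a limit
    point of the closed preimage of a compact set of finite values, and so belong to it.\<close>
  have unbounded: "\<not> F ` G \<subseteq> cball 0 B" for B
  proof
    assume "F ` G \<subseteq> cball 0 B"
    then have "G \<subseteq> {x. f x \<in> Some ` cball 0 B}"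
      using some by (force simp: G_def)
    then have "a islimpt {x. f x \<in> Some ` cball 0 B}"
      using a_lim islimpt_subset by blast
    then have "a \<in> {x. f x \<in> Some ` cball 0 B}"
      using closed_preimage_Some[OF cont, of "cball 0 B"] by (simp add: closed_limpt)
    then show False
      using fa by auto
  qed
  obtain R where R: "\<And>x. x \<in> sphere a s \<Longrightarrow> norm (F x) \<le> R"
  proof -
    have "continuous_on (- poles f) F"
      using qr by (simp add: quasiregular_on_def F_def[abs_def])
    moreover have "sphere a s \<subseteq> - poles f"
    proof
      fix x
      assume "x \<in> sphere a s"
      then have "f x = Some (F x)"
        using s by (intro some) auto
      then show "x \<in> - poles f"
        by (simp add: poles_def)
    qed
    ultimately have "compact (F ` sphere a s)"
      by (intro compact_continuous_image) (auto intro: continuous_on_subset)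
    then show ?thesis
      using compact_imp_bounded bounded_iff that by (metis imageI)
  qed
  define E where "E = - cball (0 :: real ^ 'n) (max 0 R)"
  define M where "M = E - F ` G"
  have conn_E: "connected E"
    unfolding E_def by (rule connected_complement_bounded_convex) (use N in auto)
  \<comment> \<open>\<open>G\<close> is not closed, but no point of the boundary can be approached:
    on the sphere \<open>F\<close> is at most \<open>R\<close> in norm, too far from
    \<open>y\<close>, and at \<open>a\<close> the value is infinite. So the preimage is closed in
    the compact ball.\<close>
  have comp: "compact {x \<in> G. dist (F x) y \<le> \<rho>'}" if "\<rho>' < norm y - max 0 R" for y \<rho>'
  proof -
    have "{x \<in> G. dist (F x) y \<le> \<rho>'} = cball a s \<inter> {x. f x \<in> Some ` cball y \<rho>'}"
    proof (intro set_eqI iffI)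
      fix x
      assume "x \<in> {x \<in> G. dist (F x) y \<le> \<rho>'}"
      then show "x \<in> cball a s \<inter> {x. f x \<in> Some ` cball y \<rho>'}"
        using some[of x] by (auto simp: G_def dist_commute)
    next
      fix x
      assume x: "x \<in> cball a s \<inter> {x. f x \<in> Some ` cball y \<rho>'}"
      then have "x \<noteq> a"
        using fa by auto
      with x have Fx: "dist (F x) y \<le> \<rho>'"
        using some[of x] by (auto simp: dist_commute)
      have "x \<notin> sphere a s"
      proof
        assume "x \<in> sphere a s"
        then have "norm (F x) \<le> R"
          by (rule R)
        moreover have "norm y \<le> norm (F x) + dist (F x) y"
          using norm_triangle_sub[of "y" "(F x)"] by (simp add: dist_norm norm_minus_commute)
        ultimately show False
          using Fx that by auto
      qed
      then show "x \<in> {x \<in> G. dist (F x) y \<le> \<rho>'}"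
        using x Fx \<open>x \<noteq> a\<close> by (auto simp: G_def)
    qed
    then show ?thesis
      using closed_preimage_Some[OF cont, of "cball y \<rho>'"] by (simp add: compact_Int_closed)
  qed
  \<comment> \<open>The omitted ball reaches all the way to the boundary of \<open>E\<close>; this
    explicit radius yields openness of both \<open>M\<close> and \<open>E - M\<close>.\<close>
  have M_ball: "ball y (norm y - max 0 R) \<subseteq> M" if "y \<in> M" for y
  proof
    fix z
    assume z: "z \<in> ball y (norm y - max 0 R)"
    then obtain \<rho> where \<rho>: "dist y z < \<rho>" "\<rho> < norm y - max 0 R"
      using dense by (auto simp del: max_less_iff_conj)
    obtain \<rho>' where \<rho>': "\<rho> < \<rho>'" "\<rho>' < norm y - max 0 R"
      using dense \<rho>(2) by blast
    have "0 < \<rho>"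
      using \<rho>(1) zero_le_dist[of y z] by linarith
    have "y \<notin> F ` G"
      using that by (simp add: M_def)
    from quasiregular_on_cases[OF qrG conn this \<open>0 < \<rho>\<close> \<rho>'(1) comp[OF \<rho>'(2)]]
    have "\<forall>x\<in>G. \<rho> \<le> dist (F x) y"
    proof
      assume "\<exists>c. \<forall>x\<in>G. F x = c"
      then obtain c where "\<forall>x\<in>G. F x = c" ..
      then have "F ` G \<subseteq> cball 0 (norm c)"
        by auto
      with unbounded show ?thesis by blast
    qed
    then have "z \<notin> F ` G"
      using \<rho>(1) by (force simp: dist_commute)
    moreover have "norm y \<le> norm z + dist y z"
      using norm_triangle_sub[of "y" "z"] by (simp add: dist_norm norm_minus_commute)
    then have "z \<in> E"
      using z by (auto simp: E_def)
    ultimately show "z \<in> M"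
      by (simp add: M_def)
  qed
  have "open M"
    unfolding open_contains_ball
  proof
    fix y
    assume y: "y \<in> M"
    then have "norm y - max 0 R > 0"
      by (auto simp: M_def E_def)
    with M_ball[OF y] show "\<exists>e>0. ball y e \<subseteq> M" by blast
  qed
  have "open (E - M)"
    unfolding open_contains_ball
  proof
    fix y
    assume y: "y \<in> E - M"
    \<comment> \<open>A point \<open>z\<close> of \<open>ball y d\<close> has
      \<open>norm z - max 0 R > d\<close>, so an omitted \<open>z\<close> would carry an omitted
      ball that contains \<open>y\<close>.\<close>
    define d where "d = (norm y - max 0 R) / 2"
    have d: "d > 0"
      using y by (auto simp: d_def E_def)
    have "ball y d \<subseteq> E - M"
    proof
      fix z
      assume z: "z \<in> ball y d"
      have "norm y \<le> norm z + dist y z"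
        using norm_triangle_sub[of "y" "z"] by (simp add: dist_norm norm_minus_commute)
      then have nz: "dist z y < norm z - max 0 R"
        using z by (simp add: d_def dist_commute)
      then have "max 0 R < norm z"
        using zero_le_dist[of z y] by linarith
      then have "z \<in> E"
        by (simp add: E_def del: max_less_iff_conj)
      moreover have "z \<notin> M"
      proof
        assume "z \<in> M"
        then have "y \<in> M"
          using subsetD[OF M_ball, of z y] nz unfolding mem_ball by blast
        with y show False by blast
      qed
      ultimately show "z \<in> E - M" by blast
    qed
    with d show "\<exists>e>0. ball y e \<subseteq> E - M" by blast
  qed
  have "M \<subseteq> E"
    by (auto simp: M_def)
  have "M = {} \<or> E - M = {}"
    using connectedD[OF conn_E \<open>open M\<close> \<open>open (E - M)\<close>] \<open>M \<subseteq> E\<close> by blast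
  then have "M = {}"
  proof
    assume "E - M = {}"
    then have "F ` G \<subseteq> cball 0 (max 0 R)"
      by (auto simp: M_def E_def)
    with unbounded show ?thesis by blast
  qed
  have "\<exists>x\<in>ball a r. f x = Some y" if "norm y > max 0 R" for y
  proof -
    have "y \<in> E"
      using that by (simp add: E_def del: max_less_iff_conj)
    then have "y \<in> F ` G"
      using \<open>M = {}\<close> by (auto simp: M_def)
    then obtain x where "x \<in> G" "y = F x"
      by blast
    then show ?thesis
      using some[of x] s by (intro bexI[of _ x]) (auto simp: G_def)
  qed
  then show ?thesis
    using that by blast
qed

section \<open>Orbits through a chain of compact sets\<close>

text \<open>The points of \<open>B m\<close> whose next \<open>n\<close> images run through
  \<open>B (m + 1)\<close>, ..., \<open>B (m + n)\<close>. As the recursion splits off the first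
  step of the orbit, the start index has to vary.\<close>

primrec orbit_set :: "('a \<Rightarrow> 'a option) \<Rightarrow> (nat \<Rightarrow> 'a set) \<Rightarrow> nat \<Rightarrow> nat \<Rightarrow> 'a set" where
  "orbit_set f B 0 m = B m"
| "orbit_set f B (Suc n) m = B m \<inter> {x. f x \<in> Some ` orbit_set f B n (Suc m)}"

lemma orbit_set_antimono: "orbit_set f B (Suc n) m \<subseteq> orbit_set f B n m"
proof (induction n arbitrary: m)
  case (Suc n)
  have "Some ` orbit_set f B (Suc n) (Suc m) \<subseteq> Some ` orbit_set f B n (Suc m)"
    using Suc by blast
  then show ?case
    by (subst (1 2) orbit_set.simps(2)) blast
qed simp

lemma orbit_set_subset: "orbit_set f B n m \<subseteq> B m"
  by (cases n) auto

text \<open>A point of the last set is pulled back step by step along the covering relation.\<close>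

lemma orbit_set_nonempty:
  assumes "\<And>n. B n \<noteq> {}" "\<And>n y. y \<in> B (Suc n) \<Longrightarrow> \<exists>x\<in>B n. f x = Some y"
  shows "orbit_set f B n m \<noteq> {}"
proof (induction n arbitrary: m)
  case (Suc n)
  obtain y where y: "y \<in> orbit_set f B n (Suc m)"
    using Suc by blast
  then obtain x where "x \<in> B m" "f x = Some y"
    using assms(2) orbit_set_subset by (metis subsetD)
  with y have "x \<in> orbit_set f B (Suc n) m"
    by simp
  then show ?case by blast
qed (use assms(1) in simp)

lemma orbit_set_compact:
  fixes f :: "'a::t2_space \<Rightarrow> 'a option"
  assumes "continuous_map euclidean (Alexandroff_compactification euclidean) f" "\<And>n. compact (B n)"
  shows "compact (orbit_set f B n m)"
proof (induction n arbitrary: m)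
  case (Suc n)
  show ?case
    using closed_preimage_Some[OF assms(1) Suc] assms(2) by (simp add: compact_Int_closed)
qed (use assms(2) in simp)

text \<open>\<open>orbit_set\<close> removes steps at the front while \<open>iterate\<close> adds
  them at the end; the induction on \<open>j\<close> therefore lets the remaining length
  \<open>n\<close> vary.\<close>

lemma orbit_set_iterate:
  "x \<in> orbit_set f B (n + j) m \<Longrightarrow> \<exists>z\<in>orbit_set f B n (m + j). iterate f j x = Some z"
proof (induction j arbitrary: n)
  case (Suc j)
  then have "x \<in> orbit_set f B (Suc n + j) m"
    by simp
  then obtain z where "z \<in> orbit_set f B (Suc n) (m + j)" "iterate f j x = Some z"
    using Suc.IH by blast
  then show ?case
    by auto
qed simp

text \<open>The nested compact sets \<open>orbit_set f B n 0\<close> have a common point, and the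
  \<open>n\<close>-th iterate of such a point lies in \<open>B n\<close>.\<close>

lemma escaping_set_nonempty:
  fixes f :: "real ^ 'n::finite \<Rightarrow> (real ^ 'n) option"
  assumes cont: "continuous_map euclidean (Alexandroff_compactification euclidean) f"
    and B: "\<And>n. compact (B n)" "\<And>n. B n \<noteq> {}" "\<And>n y. y \<in> B (Suc n) \<Longrightarrow> \<exists>x\<in>B n. f x = Some y"
    and large: "\<And>n x. x \<in> B n \<Longrightarrow> real n \<le> norm x"
  shows "escaping_set f \<noteq> {}"
proof -
  have "(\<Inter>n. orbit_set f B n 0) \<noteq> {}"
  proof (rule compact_nest)
    show "compact (orbit_set f B n 0)" for n
      by (rule orbit_set_compact[OF cont B(1)])
    show "orbit_set f B n 0 \<noteq> {}" for n
      by (rule orbit_set_nonempty[OF B(2,3)])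
    show "orbit_set f B n 0 \<subseteq> orbit_set f B m 0" if "m \<le> n" for m n
      using that by (rule lift_Suc_antimono_le[of "\<lambda>n. orbit_set f B n 0", OF orbit_set_antimono])
  qed
  then obtain x where x: "\<And>n. x \<in> orbit_set f B n 0"
    by blast
  have it: "\<exists>z. iterate f n x = Some z \<and> real n \<le> norm z" for n
    using orbit_set_iterate[of x f B 0 n 0] x[of n] large by auto
  have "limitin (Alexandroff_compactification euclidean) (\<lambda>n. iterate f n x) None sequentially"
    unfolding limitin_def
  proof (intro conjI allI impI)
    fix V :: "(real ^ 'n) option set"
    assume "openin (Alexandroff_compactification euclidean) V \<and> None \<in> V"
    \<comment> \<open>A neighbourhood of infinity is the complement of a compact, hence bounded,
      set, and the iterates leave it because their norms are at least \<open>n\<close>.\<close>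
    then obtain C where C: "compact C" "V = insert None (Some ` (- C))"
      by (auto simp: openin_Alexandroff_compactification Compl_eq_Diff_UNIV)
    obtain b where b: "\<And>z. z \<in> C \<Longrightarrow> norm z \<le> b"
      using compact_imp_bounded[OF C(1)] bounded_iff by metis
    obtain n0 :: nat where n0: "b < real n0"
      using reals_Archimedean2 by blast
    have "iterate f n x \<in> V" if "n \<ge> n0" for n
    proof -
      obtain z where "iterate f n x = Some z" "real n \<le> norm z"
        using it by blast
      moreover from this have "z \<notin> C"
        using b[of z] n0 that by force
      ultimately show ?thesis
        using C(2) by auto
    qed
    then show "\<forall>\<^sub>F n in sequentially. iterate f n x \<in> V"
      unfolding eventually_sequentially by blast
  qed simp
  moreover have "iterate f n x \<noteq> None" for n
    using it[of n] by auto
  ultimately have "x \<in> escaping_set f"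
    by (simp add: escaping_set_def)
  then show ?thesis by blast
qed

theorem mainTheorem3:
  fixes f :: "real ^ 'n \<Rightarrow> (real ^ 'n) option"
  assumes "CARD('n) \<ge> 2"
    and "quasimeromorphic f"
    and "infinite (poles f)"
  shows "escaping_set f \<noteq> {}"
proof -
  have cont: "continuous_map euclidean (Alexandroff_compactification euclidean) f"
    and discrete: "\<And>x. \<not> x islimpt poles f"
    using assms(2) by (auto simp: quasimeromorphic_def)
  \<comment> \<open>Infinitely many poles in a compact ball would accumulate.\<close>
  have far: "\<exists>a\<in>poles f. norm a > b" for b
  proof (rule ccontr)
    assume "\<not> (\<exists>a\<in>poles f. norm a > b)"
    then have "poles f \<subseteq> cball 0 b"
      by (auto simp: not_less)
    then show False
      using compact_cball[of "0 :: real ^ 'n" b] assms(3) discrete unfolding compact_eq_Bolzano_Weierstrass by blast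
  qed
  \<comment> \<open>The bound \<open>n + 1\<close> is chosen for balls of radius \<open>1\<close>,
    whose points then have norm at least \<open>n\<close>.\<close>
  have "\<exists>a. \<forall>n. (a n \<in> poles f \<and> norm (a n) \<ge> real n + 1) \<and>
      (\<forall>y\<in>cball (a (Suc n)) 1. \<exists>x\<in>cball (a n) 1. f x = Some y)"
  proof (rule dependent_nat_choice)
    show "\<exists>a. a \<in> poles f \<and> norm a \<ge> real 0 + 1"
      using far[of 1] by auto
    fix a n
    assume a: "a \<in> poles f \<and> norm a \<ge> real n + 1"
    obtain R where R: "\<And>y. norm y > R \<Longrightarrow> \<exists>x\<in>ball a 1. f x = Some y"
      using pole_neighbourhood_covers[OF assms(1,2), of a 1] a by auto
    \<comment> \<open>The \<open>2\<close> serves twice: the unit ball around \<open>a'\<close>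
      stays outside the ball of radius \<open>R\<close>, and the norm of \<open>a'\<close> reaches
      \<open>real (Suc n) + 1\<close>.\<close>
    obtain a' where a': "a' \<in> poles f" "norm a' > max R (real n) + 2"
      using far by blast
    have "\<exists>x\<in>cball a 1. f x = Some y" if "y \<in> cball a' 1" for y
    proof -
      have "norm a' \<le> norm y + dist a' y"
        using norm_triangle_sub[of "a'" "y"] by (simp add: dist_norm norm_minus_commute)
      then have "norm y > R"
        using that a'(2) by auto
      from R[OF this] show ?thesis
        using ball_subset_cball by blast
    qed
    then show "\<exists>b. (b \<in> poles f \<and> norm b \<ge> real (Suc n) + 1) \<and> (\<forall>y\<in>cball b 1. \<exists>x\<in>cball a 1. f x = Some y)"
      using a' by (intro exI[of _ a']) auto
  qed
  then obtain a where a: "\<And>n. norm (a n) \<ge> real n + 1"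
      "\<And>n y. y \<in> cball (a (Suc n)) 1 \<Longrightarrow> \<exists>x\<in>cball (a n) 1. f x = Some y"
    by blast
  show ?thesis
  proof (rule escaping_set_nonempty[OF cont, of "\<lambda>n. cball (a n) 1"])
    show "real n \<le> norm x" if "x \<in> cball (a n) 1" for n x
    proof -
      have "norm (a n) \<le> norm x + dist (a n) x"
        using norm_triangle_sub[of "(a n)" "x"] by (simp add: dist_norm norm_minus_commute)
      then show ?thesis
        using that a(1)[of n] by auto
    qed
  qed (use a(2) in auto)
qed

end
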